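(* Let $u^{\epsilon}$, $\epsilon>0$, denote the solution of the penalized boundary obstacle problem in $B_1^+$ with boundary datum $\varphi$. Then there exist a radius $r\in(0,1)$ and a modulus of continuity $\omega:(0,\infty)\to(0,\infty)$, both independent of $\epsilon$, with $\omega(\delta)=O(\delta^{1/2})$ as $\delta\to 0$, such that for every $\epsilon>0$ for which $u^\epsilon$ is a global solution (i.e. tangentially convex) and $u^\epsilon(0)=0$, and all distinct $p,q\in B_{r/2}^+$, $$|u^{\epsilon}_y(p)-u^{\epsilon}_y(q)|\le \omega(|p-q|).$$
   Context: Let $n\ge 2$ and write points of $\mathbb{R}^n$ as $(x,y)$ with $x\in\mathbb{R}^{n-1}$, $y\in\mathbb{R}$. $B_r$ is the open ball of radius $r$ centered at $0$, $B_r^+=B_r\cap\{y>0\}$, $B_r'=B_r\cap\{y=0\}$, $(\partial B_1)^+=\partial B_1\cap\{y>0\}$. Fix $\varphi\in C^{2,\gamma}(\overline{B_1})$ for some $\gamma\in(0,1)$, strictly positive on $\partial B_1\cap\{y=0\}$. For $\epsilon>0$ let $\beta_\epsilon(t)=t/\epsilon$ for $t<0$ and $\beta_\epsilon(t)=0$ for $t\ge 0$. The penalized boundary obstacle problem is: $\Delta u^\epsilon=0$ in $B_1^+$; $u^\epsilon_y=\beta_\epsilon(u^\epsilon)$ on $B_1'$; $u^\epsilon=\varphi$ on $(\partial B_1)^+$. Its solution $u^\epsilon$ is continuous on $\overline{B_1^+}$ and $C^1$ up to $B_1'$. A solution $u^\epsilon$ is called global if it is tangentially convex: $u^\epsilon_{\tau\tau}\ge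 0$ for every direction $\tau$ parallel to $\mathbb{R}^{n-1}\times\{0\}$. "Independent of $\epsilon$" means depending only on $n$ and $\varphi$. *)

theory Defs
  imports "HOL-Analysis.Analysis" "HOL-Library.Landau_Symbols"
begin

text \<open>
  Euclidean n-space with n at least 2 is \<^typ>\<open>(real^'m) \<times> real\<close>, where n = CARD('m) + 1;
  a point is a pair (x, y), and the norm of the product type is the Euclidean one.
\<close>

subsection \<open>Classical differentiability classes\<close>

definition partial :: "'a::euclidean_space \<Rightarrow> ('a \<Rightarrow> real) \<Rightarrow> 'a \<Rightarrow> real" where
  "partial v f p = deriv (\<lambda>t. f (p + t *\<^sub>R v)) 0"

definition C1_on :: "'a::euclidean_space set \<Rightarrow> ('a \<Rightarrow> real) \<Rightarrow> bool" where
  "C1_on S f \<longleftrightarrow> f differentiable_on S \<and> (\<forall>i\<in>Basis. continuous_on S (partial i f))"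

definition C2_on :: "'a::euclidean_space set \<Rightarrow> ('a \<Rightarrow> real) \<Rightarrow> bool" where
  "C2_on S f \<longleftrightarrow> C1_on S f \<and> (\<forall>i\<in>Basis. C1_on S (partial i f))"

definition laplacian :: "('a::euclidean_space \<Rightarrow> real) \<Rightarrow> 'a \<Rightarrow> real" where
  "laplacian f p = (\<Sum>i\<in>Basis. partial i (partial i f) p)"

definition extends_continuously ::
    "('a::euclidean_space \<Rightarrow> real) \<Rightarrow> 'a set \<Rightarrow> 'a set \<Rightarrow> bool" where
  "extends_continuously f S T \<longleftrightarrow> (\<exists>g. continuous_on T g \<and> (\<forall>p\<in>S. g p = f p))"

definition holder_on :: "real \<Rightarrow> 'a::euclidean_space set \<Rightarrow> ('a \<Rightarrow> real) \<Rightarrow> bool" where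
  "holder_on \<gamma> S f \<longleftrightarrow> (\<exists>C. \<forall>p\<in>S. \<forall>q\<in>S. \<bar>f p - f q\<bar> \<le> C * dist p q powr \<gamma>)"

text \<open>
  For a bounded open set S, the Hoelder space of order (2, gamma) on the closure of S: the
  partial derivatives of order at most 2 exist in S and extend continuously to the closure,
  and those of order 2 are uniformly Hoelder continuous in S.  The values of f itself on the
  boundary are those of the continuous extension.
\<close>
definition C2_holder_closure :: "real \<Rightarrow> 'a::euclidean_space set \<Rightarrow> ('a \<Rightarrow> real) \<Rightarrow> bool" where
  "C2_holder_closure \<gamma> S f \<longleftrightarrow>
     C2_on S f \<and> continuous_on (closure S) f \<and>
     (\<forall>i\<in>Basis. extends_continuously (partial i f) S (closure S)) \<and>
     (\<forall>i\<in>Basis. \<forall>j\<in>Basis. extends_continuously (partial j (partial i f)) S (closure S) \<and>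
        holder_on \<gamma> S (partial j (partial i f)))"

definition modulus_of_continuity :: "(real \<Rightarrow> real) \<Rightarrow> bool" where
  "modulus_of_continuity \<omega> \<longleftrightarrow>
     (\<forall>\<delta>>0. \<omega> \<delta> > 0) \<and> mono_on {0<..} \<omega> \<and> (\<omega> \<longlongrightarrow> 0) (at_right 0)"

subsection \<open>The penalized boundary obstacle problem\<close>

definition upper_half_ball :: "real \<Rightarrow> ((real^'m) \<times> real) set" where
  "upper_half_ball r = ball 0 r \<inter> {p. snd p > 0}"

definition flat_ball :: "real \<Rightarrow> ((real^'m) \<times> real) set" where
  "flat_ball r = ball 0 r \<inter> {p. snd p = 0}"

definition penalty :: "real \<Rightarrow> real \<Rightarrow> real" where
  "penalty \<epsilon> t = (if t < 0 then t / \<epsilon> else 0)"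

text \<open>
  Only the values of u on the closed upper half ball matter.  Being continuously differentiable
  up to the flat part means that the first partial derivatives extend continuously from the open
  half ball to its union with the flat part; the normal derivative on the flat part is one-sided.
\<close>
definition penalized_solution ::
    "real \<Rightarrow> ((real^'m) \<times> real \<Rightarrow> real) \<Rightarrow> ((real^'m) \<times> real \<Rightarrow> real) \<Rightarrow> bool" where
  "penalized_solution \<epsilon> \<phi> u \<longleftrightarrow>
     continuous_on (closure (upper_half_ball 1)) u \<and>
     C2_on (upper_half_ball 1) u \<and>
     (\<forall>i\<in>Basis. extends_continuously (partial i u)
        (upper_half_ball 1) (upper_half_ball 1 \<union> flat_ball 1)) \<and>
     (\<forall>p\<in>upper_half_ball 1. laplacian u p = 0) \<and>
     (\<forall>x. (x, 0) \<in> flat_ball 1 \<longrightarrow>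
        ((\<lambda>y. u (x, y)) has_real_derivative penalty \<epsilon> (u (x, 0))) (at_right 0)) \<and>
     (\<forall>p\<in>sphere 0 1 \<inter> {p. snd p > 0}. u p = \<phi> p)"

definition tangentially_convex :: "((real^'m) \<times> real \<Rightarrow> real) \<Rightarrow> bool" where
  "tangentially_convex u \<longleftrightarrow>
     (\<forall>e. norm e = 1 \<longrightarrow> (\<forall>p\<in>upper_half_ball 1. partial (e, 0) (partial (e, 0) u) p \<ge> 0))"

end

theory Submission
  imports Defs
begin

text \<open>
  Write \<open>w = u\<^sub>y\<close>. Tangential convexity makes \<open>u\<close> concave in \<open>y\<close>, so \<open>w\<close> decreases in \<open>y\<close>
  and \<open>w \<le> 0\<close>; together with \<open>\<bar>u\<bar> \<le> sup \<bar>\<phi>\<bar>\<close> this bounds \<open>w\<close> in the interior uniformly in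
  \<open>\<epsilon>\<close>. For a flat point \<open>x\<^sub>0\<close> the sublevel set \<open>{u(\<cdot>, 0) < u(x\<^sub>0, 0)}\<close> is convex and misses
  \<open>x\<^sub>0\<close>, so \<open>w \<ge> w(x\<^sub>0)\<close> on a flat half ball, by monotonicity of the penalty. On the other flat
  half ball \<open>w\<^sub>y \<le> 0\<close>, and comparison with \<open>Im \<surd>(s + \<i>y)\<close>, which solves the mixed
  Dirichlet-Neumann problem, gives \<open>w(p) \<ge> w(x\<^sub>0) - C \<surd>\<bar>p - x\<^sub>0\<bar>\<close>. Exchanging two flat points
  and using monotonicity in \<open>y\<close> yields the two-sided estimate, and an interior Lipschitz estimate
  for harmonic functions extends it to arbitrary pairs of points.
\<close>

subsection \<open>Harmonicity along coordinate lines\<close>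

text \<open>The obstacle is uniformity: the slope \<open>1 / \<epsilon>\<close> of the penalty is
  unbounded as \<open>\<epsilon>\<close> tends to 0. The penalty therefore enters only through its
  sign and its monotonicity, which are the same for every \<open>\<epsilon>\<close>; all sizes come
  from the supremum of \<open>\<phi>\<close> on the sphere and from the dimension. The exponent 1/2
  is forced by what is known near a flat point: a lower bound on one flat half and only a sign of
  the normal derivative of \<open>w\<close> on the other. The imaginary part of the square root is
  the harmonic function, homogeneous of degree 1/2, adapted to these mixed conditions. Every
  comparison is a maximum principle with an explicit barrier, perturbed to be strictly subharmonic.
  Even the interior gradient bound is of this kind, so no mean value or Poisson formula occurs. The
  radii are nested: pairs of points lie in the ball of radius 1/16, flat base points in that of
  radius 1/4, and comparison half balls in that of radius 1/2. A vertical shift of at most 1/8 then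
  stays below height 5/8, and the gap of 1/8 up to height 3/4 is what bounds \<open>w\<close> from
  below.\<close>

text \<open>
  The Laplacian as a relation built on second derivatives at \<open>0\<close> along coordinate lines: this is all
  that the second derivative test at a maximum needs, and it needs no joint differentiability.
\<close>

definition has_dd :: "(real \<Rightarrow> real) \<Rightarrow> real \<Rightarrow> bool" where
  "has_dd f D \<longleftrightarrow> (\<exists>f'. (\<forall>\<^sub>F t in nhds 0. (f has_real_derivative f' t) (at t)) \<and>
     (f' has_real_derivative D) (at 0))"

definition has_lap :: "('a::euclidean_space \<Rightarrow> real) \<Rightarrow> 'a \<Rightarrow> real \<Rightarrow> bool" where
  "has_lap f p L \<longleftrightarrow>
     (\<exists>D. (\<forall>i\<in>Basis. has_dd (\<lambda>t. f (p + t *\<^sub>R i)) (D i)) \<and> L = sum D Basis)"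

lemma has_ddI:
  assumes "\<And>t. (f has_real_derivative f' t) (at t)" "(f' has_real_derivative D) (at 0)"
  shows "has_dd f D"
  using assms unfolding has_dd_def by (auto intro!: exI[of _ f'])

lemma has_dd_add:
  assumes "has_dd f D" "has_dd g E"
  shows "has_dd (\<lambda>t. f t + g t) (D + E)"
proof -
  obtain f' g' where f: "\<forall>\<^sub>F t in nhds 0. (f has_real_derivative f' t) (at t)"
    "(f' has_real_derivative D) (at 0)" and g: "\<forall>\<^sub>F t in nhds 0. (g has_real_derivative g' t) (at t)"
    "(g' has_real_derivative E) (at 0)"
    using assms unfolding has_dd_def by blast
  have "\<forall>\<^sub>F t in nhds 0. ((\<lambda>t. f t + g t) has_real_derivative f' t + g' t) (at t)"
    using f(1) g(1) by eventually_elim (rule DERIV_add)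
  then show ?thesis
    unfolding has_dd_def using DERIV_add[OF f(2) g(2)] by (intro exI conjI)
qed

lemma has_dd_cmult:
  assumes "has_dd f D"
  shows "has_dd (\<lambda>t. c * f t) (c * D)"
proof -
  obtain f' where "\<forall>\<^sub>F t in nhds 0. (f has_real_derivative f' t) (at t)"
    "(f' has_real_derivative D) (at 0)"
    using assms unfolding has_dd_def by blast
  then show ?thesis
    unfolding has_dd_def
    by (intro exI[of _ "\<lambda>t. c * f' t"]) (auto elim!: eventually_mono intro: DERIV_cmult)
qed

lemma has_dd_mirror:
  assumes "has_dd f D"
  shows "has_dd (\<lambda>t. f (- t)) D"
proof -
  obtain f' where f: "\<forall>\<^sub>F t in nhds 0. (f has_real_derivative f' t) (at t)"
    "(f' has_real_derivative D) (at 0)"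
    using assms unfolding has_dd_def by blast
  have "filterlim uminus (nhds 0) (nhds (0::real))"
    using tendsto_minus[OF filterlim_ident[of "nhds (0::real)"]] by simp
  from eventually_compose_filterlim[OF f(1) this]
  have "\<forall>\<^sub>F t in nhds 0. ((\<lambda>t. f (- t)) has_real_derivative - f' (- t)) (at t)"
    by (rule eventually_mono) (simp add: DERIV_mirror)
  moreover have "((\<lambda>t. - f' (- t)) has_real_derivative D) (at 0)"
    using f(2) DERIV_mirror[of "\<lambda>t. f' t" D 0]
    by (auto intro!: derivative_eq_intros simp: DERIV_mirror)
  ultimately show ?thesis
    unfolding has_dd_def by (intro exI conjI)
qed

lemma has_dd_at_max:
  assumes "has_dd f D" and max: "\<forall>\<^sub>F t in nhds 0. f t \<le> f 0"
  shows "D \<le> 0"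
proof (rule ccontr)
  assume "\<not> D \<le> 0"
  obtain f' where f: "\<forall>\<^sub>F t in nhds 0. (f has_real_derivative f' t) (at t)"
    "(f' has_real_derivative D) (at 0)"
    using assms unfolding has_dd_def by blast
  obtain e where e: "e > 0" "\<And>t. \<bar>t\<bar> < e \<Longrightarrow> (f has_real_derivative f' t) (at t)"
    "\<And>t. \<bar>t\<bar> < e \<Longrightarrow> f t \<le> f 0"
    using eventually_conj[OF f(1) max] unfolding eventually_nhds_metric dist_real_def by auto
  \<comment> \<open>The derivative vanishes at the maximum; with \<open>D > 0\<close> it is positive
    just to the right of 0, so \<open>f\<close> would increase there.\<close>
  have "f' 0 = 0"
    using DERIV_local_max[of f "f' 0" 0 e] e by auto
  then obtain d where d: "d > 0" "\<And>h. 0 < h \<Longrightarrow> h < d \<Longrightarrow> f' h > 0"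
    using DERIV_pos_inc_right[OF f(2)] \<open>\<not> D \<le> 0\<close> by auto
  define t where "t = min d e / 2"
  have t: "0 < t" "t < d" "t < e" using d e by (auto simp: t_def)
  have "f 0 < f t"
  proof (rule DERIV_pos_imp_increasing_open[OF t(1)])
    show "\<exists>y. (f has_real_derivative y) (at x) \<and> 0 < y" if "0 < x" "x < t" for x
      using e(2)[of x] d(2)[of x] t that by (intro exI[of _ "f' x"]) auto
    show "continuous_on {0..t} f"
      using e(2) t by (intro DERIV_continuous_on[where D = f'])
        (auto intro: has_field_derivative_at_within)
  qed
  with e(3)[of t] t show False by simp
qed

lemma has_lap_add:
  assumes "has_lap f p L" "has_lap g p K"
  shows "has_lap (\<lambda>z. f z + g z) p (L + K)"
proof -
  obtain D E where "\<And>i. i \<in> Basis \<Longrightarrow> has_dd (\<lambda>t. f (p + t *\<^sub>R i)) (D i)" "L = sum D Basis"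
    "\<And>i. i \<in> Basis \<Longrightarrow> has_dd (\<lambda>t. g (p + t *\<^sub>R i)) (E i)" "K = sum E Basis"
    using assms unfolding has_lap_def by blast
  then show ?thesis
    unfolding has_lap_def
    by (intro exI[of _ "\<lambda>i. D i + E i"]) (auto simp: sum.distrib intro: has_dd_add)
qed

lemma has_lap_cmult:
  assumes "has_lap f p L"
  shows "has_lap (\<lambda>z. c * f z) p (c * L)"
proof -
  obtain D where "\<And>i. i \<in> Basis \<Longrightarrow> has_dd (\<lambda>t. f (p + t *\<^sub>R i)) (D i)" "L = sum D Basis"
    using assms unfolding has_lap_def by blast
  then show ?thesis
    unfolding has_lap_def
    by (intro exI[of _ "\<lambda>i. c * D i"]) (auto simp: sum_distrib_left intro: has_dd_cmult)
qed

lemma has_lap_diff: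
  assumes "has_lap f p L" "has_lap g p K"
  shows "has_lap (\<lambda>z. f z - g z) p (L - K)"
  using has_lap_add[OF assms(1) has_lap_cmult[OF assms(2), of "-1"]] by simp

lemma has_lap_const: "has_lap (\<lambda>z. c) p 0"
proof -
  have "has_dd (\<lambda>t. c) 0"
    by (rule has_ddI[of _ "\<lambda>t. 0"]) (auto intro!: derivative_eq_intros)
  then show ?thesis
    unfolding has_lap_def by (intro exI[of _ "\<lambda>i. 0"]) auto
qed

lemma has_lap_translate:
  assumes "has_lap f (p + a) L"
  shows "has_lap (\<lambda>z. f (z + a)) p L"
  using assms unfolding has_lap_def by (simp add: algebra_simps)

lemma has_lap_inner: "has_lap (\<lambda>z. z \<bullet> a) p 0"
proof -
  have "has_dd (\<lambda>t. (p + t *\<^sub>R i) \<bullet> a) 0" for i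
    by (rule has_ddI[of _ "\<lambda>t. i \<bullet> a"]) (auto intro!: derivative_eq_intros simp: inner_add_left)
  then show ?thesis
    unfolding has_lap_def by (intro exI[of _ "\<lambda>i. 0"]) auto
qed

lemma norm_power2_eq_sum: "(norm (a::'a::euclidean_space))\<^sup>2 = (\<Sum>i\<in>Basis. (i \<bullet> a)\<^sup>2)"
  using euclidean_inner[of a a] by (simp add: power2_norm_eq_inner power2_eq_square[of "_ \<bullet> _"] inner_commute)

lemma has_lap_inner_power2:
  fixes a :: "'a::euclidean_space"
  shows "has_lap (\<lambda>z. (z \<bullet> a)\<^sup>2) p (2 * (norm a)\<^sup>2)"
proof -
  have "has_dd (\<lambda>t. ((p + t *\<^sub>R i) \<bullet> a)\<^sup>2) (2 * (i \<bullet> a)\<^sup>2)" for i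
    by (rule has_ddI[of _ "\<lambda>t. 2 * (i \<bullet> a) * ((p + t *\<^sub>R i) \<bullet> a)"])
      (auto intro!: derivative_eq_intros simp: inner_add_left power2_eq_square algebra_simps)
  then show ?thesis
    unfolding has_lap_def
    by (intro exI[of _ "\<lambda>i. 2 * (i \<bullet> a)\<^sup>2"])
      (simp add: norm_power2_eq_sum sum_distrib_left)
qed

lemma has_lap_norm_power2: "has_lap (\<lambda>z. (norm z)\<^sup>2) (p::'a::euclidean_space) (2 * real DIM('a))"
proof -
  have "has_dd (\<lambda>t. (norm (p + t *\<^sub>R i))\<^sup>2) 2" if "i \<in> Basis" for i
    unfolding power2_norm_eq_inner
    by (rule has_ddI[of _ "\<lambda>t. 2 * (p \<bullet> i) + 2 * t"])
      (use that in \<open>auto intro!: derivative_eq_intros simp: inner_add_left inner_add_right inner_commute\<close>)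
  then show ?thesis
    unfolding has_lap_def by (intro exI[of _ "\<lambda>i. 2"]) auto
qed

lemma has_lap_at_max:
  assumes "has_lap f p L" and max: "\<forall>\<^sub>F z in nhds p. f z \<le> f p"
  shows "L \<le> 0"
proof -
  obtain D where D: "\<And>i. i \<in> Basis \<Longrightarrow> has_dd (\<lambda>t. f (p + t *\<^sub>R i)) (D i)" "L = sum D Basis"
    using assms unfolding has_lap_def by blast
  have "D i \<le> 0" if "i \<in> Basis" for i
  proof (rule has_dd_at_max[OF D(1)[OF that]])
    have "filterlim (\<lambda>t. p + t *\<^sub>R i) (nhds (p + 0 *\<^sub>R i)) (nhds 0)"
      by (intro tendsto_intros filterlim_ident)
    then have "filterlim (\<lambda>t. p + t *\<^sub>R i) (nhds p) (nhds 0)" by simp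
    from eventually_compose_filterlim[OF max this]
    show "\<forall>\<^sub>F t in nhds 0. f (p + t *\<^sub>R i) \<le> f (p + 0 *\<^sub>R i)" by simp
  qed
  then show ?thesis using D(2) by (simp add: sum_nonpos)
qed

section \<open>Interior Lipschitz estimate for harmonic functions, by reflection\<close>

text \<open>For a unit vector \<open>b\<close> this is the reflection across the hyperplane through
  \<open>c\<close> orthogonal to \<open>b\<close>.\<close>

definition mirror :: "'a::euclidean_space \<Rightarrow> 'a \<Rightarrow> 'a \<Rightarrow> 'a" where
  "mirror b c z = z - (2 * ((z - c) \<bullet> b)) *\<^sub>R b"

text \<open>Since \<open>b\<close> is a basis vector, coordinate lines go to coordinate lines: the
  one along \<open>b\<close> is reversed, which a second derivative does not notice, and the others
  keep their direction.\<close>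

lemma has_lap_mirror:
  assumes "b \<in> Basis" "has_lap f (mirror b c p) L"
  shows "has_lap (\<lambda>z. f (mirror b c z)) p L"
proof -
  obtain D where D: "\<And>i. i \<in> Basis \<Longrightarrow> has_dd (\<lambda>t. f (mirror b c p + t *\<^sub>R i)) (D i)" "L = sum D Basis"
    using assms unfolding has_lap_def by blast
  have "has_dd (\<lambda>t. f (mirror b c (p + t *\<^sub>R i))) (D i)" if "i \<in> Basis" for i
  proof (cases "i = b")
    case True
    have "mirror b c (p + t *\<^sub>R i) = mirror b c p + (- t) *\<^sub>R i" for t
      using True assms(1) by (simp add: mirror_def algebra_simps inner_add_left inner_diff_left
        scaleR_2[symmetric] del: scaleR_2)
    then show ?thesis using has_dd_mirror[OF D(1)[OF that]] by simp
  next
    case False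
    have "mirror b c (p + t *\<^sub>R i) = mirror b c p + t *\<^sub>R i" for t
      using False assms(1) that
      by (simp add: mirror_def algebra_simps inner_add_left inner_diff_left inner_not_same_Basis)
    then show ?thesis using D(1)[OF that] by simp
  qed
  then show ?thesis unfolding has_lap_def using D(2) by blast
qed

lemma dist_mirror:
  assumes "norm b = 1"
  shows "dist c (mirror b c z) = dist c z"
proof -
  have "(norm (mirror b c z - c))\<^sup>2 = (norm (z - c))\<^sup>2"
    using assms unfolding mirror_def power2_norm_eq_inner norm_eq_1
    by (simp add: algebra_simps inner_add_left inner_diff_left inner_add_right inner_diff_right
      inner_commute)
  then show ?thesis
    by (simp add: dist_norm norm_minus_commute)
qed

text \<open>Antisymmetrising \<open>f\<close> across the hyperplane midway between the two points
  turns the difference into the value at one point of a harmonic function that vanishes on that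
  hyperplane and is at most \<open>A\<close> on the sphere. A barrier growing linearly from the
  hyperplane then gives the rate \<open>t / \<rho>\<close>.\<close>

lemma harmonic_axis_lipschitz:
  fixes f :: "'a::euclidean_space \<Rightarrow> real" and t \<rho> A :: real
  assumes b: "b \<in> Basis" and \<rho>: "0 < \<rho>" and t: "0 \<le> t" "t \<le> \<rho>"
    and cont: "continuous_on (cball c \<rho>) f"
    and harm: "\<And>z. z \<in> ball c \<rho> \<Longrightarrow> has_lap f z 0"
    and osc: "\<And>z z'. z \<in> cball c \<rho> \<Longrightarrow> z' \<in> cball c \<rho> \<Longrightarrow> f z - f z' \<le> A"
  shows "f (c + t *\<^sub>R b) - f (c - t *\<^sub>R b) \<le> DIM('a) * A * t / \<rho>"
proof -
  define n where "n = real DIM('a)"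
  have n1: "n \<ge> 1" unfolding n_def using DIM_positive[where 'a = 'a] by linarith
  have nb: "norm b = 1" using b by simp
  have A0: "A \<ge> 0" using osc[of c c] \<rho> by simp
  define K where "K = cball c \<rho> \<inter> {z. 0 \<le> (z - c) \<bullet> b}"
  \<comment> \<open>Let \<open>t = (z - c) \<bullet> b\<close>. On the sphere the quadratic part
    equals \<open>A - A * n * t\<^sup>2 / \<rho>\<^sup>2\<close>, and the linear part makes up for
    the loss because \<open>0 \<le> t \<le> \<rho>\<close>. On the axis the quadratic part is
    nonpositive, so the linear part is the final bound.\<close>
  define H where "H z = A / \<rho>\<^sup>2 * ((norm (z + - c))\<^sup>2 - n * ((z + - c) \<bullet> b)\<^sup>2) +
    (A * n / \<rho>) * ((z + - c) \<bullet> b)" for z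
  define g where "g z = f z - f (mirror b c z)" for z
  have mirK: "mirror b c z \<in> cball c \<rho>" if "z \<in> cball c \<rho>" for z
    using that dist_mirror[OF nb, of c z] by simp
  have contm: "continuous_on S (mirror b c)" for S
    unfolding mirror_def by (intro continuous_intros)
  have contg: "continuous_on K g"
    unfolding g_def
  proof (intro continuous_intros)
    show "continuous_on K f" by (rule continuous_on_subset[OF cont]) (auto simp: K_def)
    show "continuous_on K (\<lambda>z. f (mirror b c z))"
      by (rule continuous_on_compose2[OF cont contm]) (use mirK in \<open>auto simp: K_def\<close>)
  qed
  have "compact K"
    unfolding K_def
    by (intro compact_Int_closed compact_cball closed_Collect_le continuous_intros)
  \<comment> \<open>\<open>g\<close> is odd under the reflection, hence zero on the flat part of the half ball \<open>K\<close>; \<open>H\<close> is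
     harmonic, nonnegative there, and at least \<open>A\<close> on the spherical part.\<close>
  have key: "g z \<le> H z + \<eta> * \<rho>\<^sup>2" if "\<eta> > 0" "z \<in> K" for \<eta> z
  proof -
    \<comment> \<open>The last term raises the Laplacian of \<open>v\<close> to
      \<open>2 * n * \<eta> > 0\<close>, which excludes an interior maximum; it costs at most
      \<open>\<eta> * \<rho>\<^sup>2\<close> and is removed by letting \<open>\<eta>\<close> tend to
      0.\<close>
    define v where "v z = g z - H z + \<eta> * (norm (z + - c))\<^sup>2" for z
    have "continuous_on K v"
      unfolding v_def H_def by (intro continuous_intros contg)
    moreover have "K \<noteq> {}" using that(2) by blast
    ultimately obtain m where m: "m \<in> K" "\<And>z. z \<in> K \<Longrightarrow> v z \<le> v m"
      using continuous_attains_sup[OF \<open>compact K\<close>] by blast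
    have mc: "norm (m + - c) \<le> \<rho>" "0 \<le> (m - c) \<bullet> b"
      using m(1) by (auto simp: K_def dist_norm norm_minus_commute)
    have tr: "(m - c) \<bullet> b \<le> \<rho>"
      using Cauchy_Schwarz_ineq2[of "m - c" b] nb mc by simp
    have "v m \<le> \<eta> * \<rho>\<^sup>2"
    proof -
      have nn: "\<eta> * (norm (m + - c))\<^sup>2 \<le> \<eta> * \<rho>\<^sup>2"
        using that mc by (intro mult_left_mono power_mono) auto
      consider "(m - c) \<bullet> b = 0" | "norm (m - c) = \<rho>" | "norm (m - c) < \<rho>" "0 < (m - c) \<bullet> b"
        using mc by force
      then show ?thesis
      proof cases
        case 1
        then have "g m = 0" by (simp add: g_def mirror_def)
        moreover have "H m \<ge> 0" using 1 A0 by (simp add: H_def)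
        ultimately show ?thesis using nn by (simp add: v_def)
      next
        case 2
        have "g m \<le> A"
          unfolding g_def using m(1) mirK by (intro osc) (auto simp: K_def)
        moreover have "H m \<ge> A"
        proof -
          let ?t = "(m - c) \<bullet> b"
          have "H m = A + A * n * ?t * (\<rho> - ?t) / \<rho>\<^sup>2"
            using 2 \<rho> by (simp add: H_def field_simps power2_eq_square)
          then show ?thesis
            using mc tr A0 n1 \<rho> by simp
        qed
        ultimately show ?thesis using nn by (simp add: v_def)
      next
        case 3
        have mb: "m \<in> ball c \<rho>" using 3 by (simp add: dist_norm norm_minus_commute)
        have hg: "has_lap g m (0 - 0)"
          unfolding g_def
          by (intro has_lap_diff has_lap_mirror b harm mb)
            (use mb dist_mirror[OF nb, of c m] in simp)
        have hH: "has_lap H m (A / \<rho>\<^sup>2 * (2 * real DIM('a) - n * (2 * (norm b)\<^sup>2)) + (A * n / \<rho>) * 0)"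
          unfolding H_def
          by (intro has_lap_add has_lap_cmult has_lap_diff has_lap_translate[of _ m "- c"]
             has_lap_translate[where f = "\<lambda>z. z \<bullet> b"] has_lap_translate[where f = "\<lambda>z. (z \<bullet> b)\<^sup>2"]
             has_lap_translate[where f = "\<lambda>z. (norm z)\<^sup>2"]
             has_lap_norm_power2 has_lap_inner has_lap_inner_power2)
        have "has_lap v m ((0 - 0) - (A / \<rho>\<^sup>2 * (2 * real DIM('a) - n * (2 * (norm b)\<^sup>2)) + (A * n / \<rho>) * 0)
          + \<eta> * (2 * real DIM('a)))"
          unfolding v_def
          by (intro has_lap_add has_lap_diff has_lap_cmult
            has_lap_translate[where f = "\<lambda>z. (norm z)\<^sup>2"] hg hH has_lap_norm_power2)
        then have "has_lap v m (\<eta> * (2 * n))" using nb by (simp add: n_def)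
        moreover have "\<forall>\<^sub>F z in nhds m. v z \<le> v m"
        proof -
          have "open (ball c \<rho> \<inter> {z. 0 < (z - c) \<bullet> b})"
            by (intro open_Int open_ball open_Collect_less continuous_intros)
          then have "\<forall>\<^sub>F z in nhds m. z \<in> ball c \<rho> \<inter> {z. 0 < (z - c) \<bullet> b}"
            using mb 3 by (intro eventually_nhds_in_open) auto
          then show ?thesis
            by (rule eventually_mono) (rule m(2), auto simp: K_def)
        qed
        ultimately have "\<eta> * (2 * n) \<le> 0" by (rule has_lap_at_max)
        then show ?thesis using that n1 by (simp add: mult_le_0_iff)
      qed
    qed
    then have "v z \<le> \<eta> * \<rho>\<^sup>2" using m(2)[OF that(2)] by simp
    moreover have "g z - H z \<le> v z" using that by (simp add: v_def)
    ultimately show ?thesis by simp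
  qed
  have zK: "c + t *\<^sub>R b \<in> K"
    using t nb by (simp add: K_def dist_norm power2_norm_eq_inner[symmetric])
  have "g (c + t *\<^sub>R b) \<le> H (c + t *\<^sub>R b)"
  proof (rule field_le_epsilon)
    fix e :: real assume "e > 0"
    then show "g (c + t *\<^sub>R b) \<le> H (c + t *\<^sub>R b) + e"
      using key[of "e / \<rho>\<^sup>2", OF _ zK] \<rho> by simp
  qed
  also have "H (c + t *\<^sub>R b) = A / \<rho>\<^sup>2 * (t\<^sup>2 * (1 - n)) + A * n * t / \<rho>"
    using nb by (simp add: H_def power2_norm_eq_inner[symmetric] power_mult_distrib algebra_simps)
  also have "\<dots> \<le> A * n * t / \<rho>"
    using A0 n1 by (simp add: mult_nonneg_nonpos divide_nonpos_nonneg)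
  finally have "g (c + t *\<^sub>R b) \<le> n * A * t / \<rho>" by (simp add: mult_ac)
  moreover have "mirror b c (c + t *\<^sub>R b) = c - t *\<^sub>R b"
    using nb by (simp add: mirror_def norm_eq_1 algebra_simps scaleR_2[symmetric] del: scaleR_2)
  ultimately show ?thesis by (simp add: g_def n_def)
qed

corollary harmonic_axis_lipschitz_abs:
  fixes f :: "'a::euclidean_space \<Rightarrow> real" and t \<rho> A :: real
  assumes b: "b \<in> Basis" and \<rho>: "0 < \<rho>" and t: "\<bar>t\<bar> \<le> \<rho>"
    and cont: "continuous_on (cball c \<rho>) f"
    and harm: "\<And>z. z \<in> ball c \<rho> \<Longrightarrow> has_lap f z 0"
    and osc: "\<And>z z'. z \<in> cball c \<rho> \<Longrightarrow> z' \<in> cball c \<rho> \<Longrightarrow> f z - f z' \<le> A"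
  shows "\<bar>f (c + t *\<^sub>R b) - f (c - t *\<^sub>R b)\<bar> \<le> DIM('a) * A * \<bar>t\<bar> / \<rho>"
proof -
  have "f (c + \<bar>t\<bar> *\<^sub>R b) - f (c - \<bar>t\<bar> *\<^sub>R b) \<le> DIM('a) * A * \<bar>t\<bar> / \<rho>"
    by (rule harmonic_axis_lipschitz[OF b \<rho> _ t cont harm osc]) auto
  moreover have "- 1 * f (c + \<bar>t\<bar> *\<^sub>R b) - - 1 * f (c - \<bar>t\<bar> *\<^sub>R b) \<le> DIM('a) * A * \<bar>t\<bar> / \<rho>"
  proof (rule harmonic_axis_lipschitz[OF b \<rho> _ t])
    show "continuous_on (cball c \<rho>) (\<lambda>z. - 1 * f z)" by (intro continuous_intros cont)
    show "has_lap (\<lambda>z. - 1 * f z) z 0" if "z \<in> ball c \<rho>" for z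
      using has_lap_cmult[OF harm[OF that], of "- 1"] by simp
    show "- 1 * f z - - 1 * f z' \<le> A" if "z \<in> cball c \<rho>" "z' \<in> cball c \<rho>" for z z'
      using osc[OF that(2,1)] by simp
  qed auto
  ultimately show ?thesis by (cases "0 \<le> t") (auto simp: abs_le_iff)
qed

subsection \<open>The mixed boundary barrier\<close>

lemma has_dd_cong:
  assumes "has_dd f D" "\<forall>\<^sub>F t in nhds 0. f t = g t"
  shows "has_dd g D"
proof -
  obtain f' where f: "\<forall>\<^sub>F t in nhds 0. (f has_real_derivative f' t) (at t)"
    "(f' has_real_derivative D) (at 0)"
    using assms unfolding has_dd_def by blast
  have "\<forall>\<^sub>F s in nhds 0. \<forall>\<^sub>F t in nhds s. f t = g t"
    using assms(2) by (simp add: eventually_eventually)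
  with f(1) have "\<forall>\<^sub>F t in nhds 0. (g has_real_derivative f' t) (at t)"
    by eventually_elim (metis DERIV_cong_ev)
  then show ?thesis
    unfolding has_dd_def using f(2) by (intro exI conjI)
qed

lemma DERIV_Im:
  assumes "(f has_field_derivative D) (at (complex_of_real t))"
  shows "((\<lambda>t. Im (f (of_real t))) has_real_derivative Im D) (at t)"
  using bounded_linear.has_vector_derivative[OF bounded_linear_Im has_vector_derivative_real_field[OF assms]]
  by (simp add: has_real_derivative_iff_has_vector_derivative)

text \<open>The imaginary part of the square root of \<open>x \<bullet> e + \<i> y\<close>: it vanishes where \<open>y = 0\<close> and
  \<open>x \<bullet> e \<ge> 0\<close>, and has zero normal derivative where \<open>y = 0\<close> and \<open>x \<bullet> e < 0\<close>.\<close>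

definition slit_root :: "real^'m \<Rightarrow> (real^'m) \<times> real \<Rightarrow> real" where
  "slit_root e p = sqrt ((sqrt ((fst p \<bullet> e)\<^sup>2 + (snd p)\<^sup>2) - fst p \<bullet> e) / 2)"

lemma continuous_on_slit_root [continuous_intros]:
  assumes "continuous_on S f"
  shows "continuous_on S (\<lambda>z. slit_root e (f z))"
  unfolding slit_root_def by (intro continuous_intros assms) auto

lemma slit_root_nonneg: "0 \<le> slit_root e p"
proof -
  have "fst p \<bullet> e \<le> sqrt ((fst p \<bullet> e)\<^sup>2 + (snd p)\<^sup>2)" by (rule real_le_rsqrt) simp
  then show ?thesis by (simp add: slit_root_def)
qed

lemma slit_root_eq_Im_csqrt:
  "snd p > 0 \<Longrightarrow> slit_root e p = Im (csqrt (Complex (fst p \<bullet> e) (snd p)))"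
  by (simp add: slit_root_def cmod_def)

text \<open>The function is a holomorphic function of the complex linear coordinate
  \<open>\<eta>\<close>, so its second derivative along \<open>i\<close> is the imaginary part of
  \<open>(\<eta> i)\<^sup>2\<close> times a fixed complex number. The squares
  \<open>(\<eta> i)\<^sup>2\<close> sum to
  \<open>(norm e)\<^sup>2 + \<i>\<^sup>2 = 0\<close>.\<close>

lemma has_lap_slit_root:
  fixes e :: "real^'m"
  assumes "norm e = 1" "snd p > 0"
  shows "has_lap (slit_root e) p 0"
proof -
  define \<eta> where "\<eta> i = Complex (fst i \<bullet> e) (snd i)" for i :: "(real^'m) \<times> real"
  \<comment> \<open>The second complex derivative of the square root at
    \<open>\<eta> p\<close>.\<close>
  define c where "c = - 1 / (4 * csqrt (\<eta> p) ^ 3)"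
  \<comment> \<open>The open upper half plane avoids the branch cut of \<open>csqrt\<close>.\<close>
  have np: "\<eta> p + of_real t * \<eta> i \<notin> \<real>\<^sub>\<le>\<^sub>0" if "snd (p + t *\<^sub>R i) > 0" for t i
    using that by (auto simp: \<eta>_def complex_nonpos_Reals_iff)
  have dd: "has_dd (\<lambda>t. slit_root e (p + t *\<^sub>R i)) (Im ((\<eta> i)\<^sup>2 * c))" for i
  proof (rule has_dd_cong)
    have "filterlim (\<lambda>t. snd (p + t *\<^sub>R i)) (nhds (snd (p + 0 *\<^sub>R i))) (nhds 0)"
      by (intro tendsto_intros filterlim_ident)
    then have ev: "\<forall>\<^sub>F t in nhds 0. snd (p + t *\<^sub>R i) > 0"
      using assms(2) by (intro order_tendstoD) auto
    then show "\<forall>\<^sub>F t in nhds 0. Im (csqrt (\<eta> p + of_real t * \<eta> i)) = slit_root e (p + t *\<^sub>R i)"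
    proof eventually_elim
      case (elim t)
      have "\<eta> p + of_real t * \<eta> i = Complex (fst (p + t *\<^sub>R i) \<bullet> e) (snd (p + t *\<^sub>R i))"
        by (simp add: \<eta>_def complex_eq_iff inner_add_left)
      then show ?case using slit_root_eq_Im_csqrt[OF elim] by simp
    qed
    show "has_dd (\<lambda>t. Im (csqrt (\<eta> p + of_real t * \<eta> i))) (Im ((\<eta> i)\<^sup>2 * c))"
      unfolding has_dd_def
    proof (intro exI[of _ "\<lambda>t. Im (\<eta> i / (2 * csqrt (\<eta> p + of_real t * \<eta> i)))"] conjI)
      show "\<forall>\<^sub>F t in nhds 0. ((\<lambda>t. Im (csqrt (\<eta> p + of_real t * \<eta> i))) has_real_derivative
          Im (\<eta> i / (2 * csqrt (\<eta> p + of_real t * \<eta> i)))) (at t)"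
        using ev
      proof eventually_elim
        case (elim t)
        show ?case
          by (rule DERIV_Im[where f = "\<lambda>z. csqrt (\<eta> p + z * \<eta> i)"])
            (use np[OF elim] in \<open>auto intro!: derivative_eq_intros\<close>)
      qed
      have "\<eta> p \<noteq> 0" "csqrt (\<eta> p) \<noteq> 0" using np[of 0 i] assms(2) by auto
      have "((\<lambda>z. \<eta> i / (2 * csqrt (\<eta> p + z * \<eta> i))) has_field_derivative (\<eta> i)\<^sup>2 * c) (at (of_real 0))"
        using np[of 0 i] assms(2) \<open>csqrt (\<eta> p) \<noteq> 0\<close>
        by (auto intro!: derivative_eq_intros simp: c_def field_simps power2_eq_square power3_eq_cube)
      from DERIV_Im[OF this]
      show "((\<lambda>t. Im (\<eta> i / (2 * csqrt (\<eta> p + of_real t * \<eta> i)))) has_real_derivative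
          Im ((\<eta> i)\<^sup>2 * c)) (at 0)" by simp
    qed
  qed
  have "(\<Sum>i\<in>Basis. (\<eta> i)\<^sup>2) = (\<Sum>i\<in>Basis. (of_real (i \<bullet> e))\<^sup>2) + \<i>\<^sup>2"
  proof -
    have \<eta>j: "\<eta> (j, 0) = of_real (j \<bullet> e)" for j by (simp add: \<eta>_def complex_eq_iff)
    have "(\<Sum>i\<in>Basis. (\<eta> i)\<^sup>2) = (\<Sum>j\<in>Basis. (\<eta> (j, 0))\<^sup>2) + (\<Sum>j\<in>Basis. (\<eta> (0, j))\<^sup>2)"
      unfolding Basis_prod_def
      by (subst sum.union_disjoint) (auto simp: sum.reindex inj_on_def)
    also have "(\<Sum>j\<in>Basis. (\<eta> (0, j))\<^sup>2) = \<i>\<^sup>2" by (simp add: \<eta>_def Complex_eq)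
    finally show ?thesis by (simp only: \<eta>j)
  qed
  also have "(\<Sum>i\<in>Basis. (complex_of_real (i \<bullet> e))\<^sup>2) = of_real ((norm e)\<^sup>2)"
    by (simp add: norm_power2_eq_sum)
  finally have "(\<Sum>i\<in>Basis. (\<eta> i)\<^sup>2) = 0" using assms(1) by simp
  then have "(\<Sum>i\<in>Basis. Im ((\<eta> i)\<^sup>2 * c)) = 0"
    by (simp only: Im_sum[symmetric] sum_distrib_right[symmetric]) simp
  then show ?thesis
    unfolding has_lap_def using dd by metis
qed

lemma slit_root_le: "norm e = 1 \<Longrightarrow> slit_root e p \<le> sqrt (norm p)"
proof -
  assume e: "norm e = 1"
  have "\<bar>fst p \<bullet> e\<bar> \<le> norm (fst p)" using Cauchy_Schwarz_ineq2[of "fst p" e] e by simp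
  then have "(fst p \<bullet> e)\<^sup>2 \<le> (norm (fst p))\<^sup>2" by (simp add: abs_le_square_iff[symmetric])
  then have "sqrt ((fst p \<bullet> e)\<^sup>2 + (snd p)\<^sup>2) \<le> norm p"
    by (cases p) (simp add: norm_Pair)
  moreover have "- (fst p \<bullet> e) \<le> sqrt ((fst p \<bullet> e)\<^sup>2 + (snd p)\<^sup>2)" by (rule real_le_rsqrt) simp
  ultimately show ?thesis unfolding slit_root_def by (intro real_sqrt_le_mono) simp
qed

text \<open>With \<open>s = fst p \<bullet> e\<close> and
  \<open>r = sqrt (s\<^sup>2 + (snd p)\<^sup>2)\<close>, the square of the root is
  \<open>(r - s) / 2\<close>, while \<open>(r - s) * (r + s) = (snd p)\<^sup>2\<close> and
  \<open>r + s \<le> 2 * \<rho>\<close>.\<close>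

lemma slit_root_ge:
  assumes "norm e = 1" "norm p \<le> \<rho>" "0 < \<rho>" "0 \<le> snd p"
  shows "snd p / (2 * sqrt \<rho>) \<le> slit_root e p"
proof -
  define s where "s = fst p \<bullet> e"
  define r where "r = sqrt (s\<^sup>2 + (snd p)\<^sup>2)"
  have "\<bar>s\<bar> \<le> norm (fst p)" using Cauchy_Schwarz_ineq2[of "fst p" e] assms by (simp add: s_def)
  then have "s\<^sup>2 \<le> (norm (fst p))\<^sup>2" by (simp add: abs_le_square_iff[symmetric])
  then have "r \<le> norm p"
    by (cases p) (simp add: norm_Pair r_def)
  moreover have rs: "s \<le> r" unfolding r_def by (rule real_le_rsqrt) simp
  ultimately have "r + s \<le> 2 * \<rho>" "0 \<le> r - s" using assms by auto
  have "(snd p)\<^sup>2 = (r - s) * (r + s)" by (simp add: r_def algebra_simps power2_eq_square[symmetric])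
  also have "\<dots> \<le> (r - s) * (2 * \<rho>)"
    using \<open>r + s \<le> 2 * \<rho>\<close> \<open>0 \<le> r - s\<close> by (intro mult_left_mono)
  finally have "(snd p)\<^sup>2 / (2 * \<rho>) \<le> r - s" using assms by (simp add: field_simps)
  then have "(snd p / (2 * sqrt \<rho>))\<^sup>2 \<le> (r - s) / 2"
    using assms by (simp add: power_divide power_mult_distrib)
  then show ?thesis
    unfolding slit_root_def r_def[symmetric] s_def[symmetric] by (rule real_le_rsqrt)
qed

text \<open>The left side is the slit root at height \<open>y\<close> over a flat point with
  \<open>fst p \<bullet> e = - a\<close>, and \<open>sqrt a\<close> is its flat value. This is the
  zero Neumann condition in quantitative form, without differentiating at the boundary.\<close>

lemma slit_root_growth:
  assumes "a > 0"
  shows "sqrt ((sqrt (a\<^sup>2 + y\<^sup>2) + a) / 2) \<le> sqrt a + y\<^sup>2 / (8 * a * sqrt a)"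
proof (rule real_le_lsqrt)
  have "sqrt (a\<^sup>2 + y\<^sup>2) \<le> a + y\<^sup>2 / (2 * a)"
  proof (rule real_le_lsqrt)
    have "(a + y\<^sup>2 / (2 * a))\<^sup>2 = a\<^sup>2 + y\<^sup>2 + (y\<^sup>2 / (2 * a))\<^sup>2"
      using assms by (simp add: power2_sum)
    then show "a\<^sup>2 + y\<^sup>2 \<le> (a + y\<^sup>2 / (2 * a))\<^sup>2" by simp
  qed (use assms in auto)
  then have "(sqrt (a\<^sup>2 + y\<^sup>2) + a) / 2 \<le> (a + y\<^sup>2 / (2 * a) + a) / 2" by simp
  also have "\<dots> = a + y\<^sup>2 / (4 * a)" using assms by (simp add: field_simps)
  also have "\<dots> \<le> a + y\<^sup>2 / (4 * a) + (y\<^sup>2 / (8 * a * sqrt a))\<^sup>2" by simp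
  also have "\<dots> = (sqrt a + y\<^sup>2 / (8 * a * sqrt a))\<^sup>2"
  proof -
    have "2 * sqrt a * (y\<^sup>2 / (8 * a * sqrt a)) = y\<^sup>2 / (4 * a)"
      using assms by (simp add: field_simps)
    then show ?thesis using assms by (simp add: power2_sum)
  qed
  finally show "(sqrt (a\<^sup>2 + y\<^sup>2) + a) / 2 \<le> (sqrt a + y\<^sup>2 / (8 * a * sqrt a))\<^sup>2" .
qed (use assms in auto)

text \<open>Maximum principle for the mixed problem: \<open>pos\<close> is the Dirichlet side, and
  \<open>mono\<close> replaces the sign of a normal derivative on the Neumann side, so no
  differentiability up to the flat part is required and difference quotients qualify. In the factor
  \<open>2 * n + 1\<close>, the part \<open>2 * n\<close> comes from the slit root in the barrier
  and 1 from its quadratic term.\<close>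

lemma slit_comparison:
  fixes f :: "(real^'m) \<times> real \<Rightarrow> real" and x0 e :: "real^'m"
  defines "K \<rho> \<equiv> cball (x0, 0) \<rho> \<inter> {p. 0 \<le> snd p}"
  assumes \<rho>: "0 < \<rho>" and e: "norm e = 1" and C: "0 \<le> C"
    and cont: "continuous_on (K \<rho>) f"
    and harm: "\<And>p. p \<in> K \<rho> \<Longrightarrow> dist (x0, 0) p < \<rho> \<Longrightarrow> snd p > 0 \<Longrightarrow> has_lap f p 0"
    and bound: "\<And>p. p \<in> K \<rho> \<Longrightarrow> - C \<le> f p"
    and pos: "\<And>x. (x, 0) \<in> K \<rho> \<Longrightarrow> 0 \<le> (x - x0) \<bullet> e \<Longrightarrow> 0 \<le> f (x, 0)"
    and mono: "\<And>x y. (x, y) \<in> K \<rho> \<Longrightarrow> f (x, y) \<le> f (x, 0)"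
    and p: "p \<in> K \<rho>"
  shows "- (C * (2 * real DIM((real^'m) \<times> real) + 1) * sqrt (dist (x0, 0) p / \<rho>)) \<le> f p"
proof -
  define n where "n = real DIM((real^'m) \<times> real)"
  have n1: "n \<ge> 1" by (simp add: n_def)
  define c :: "(real^'m) \<times> real" where "c = (x0, 0)"
  define u :: "(real^'m) \<times> real" where "u = (0, 1)"
  define B where "B z = 2 * n / sqrt \<rho> * slit_root e (z + - c) +
    1 / \<rho>\<^sup>2 * ((norm (z + - c))\<^sup>2 - n * (z \<bullet> u)\<^sup>2)" for z
  have zu: "z \<bullet> u = snd z" for z by (simp add: u_def inner_prod_def)
  have nd: "norm (z + - c) = dist c z" for z
    by (metis dist_commute dist_norm diff_conv_add_uminus)
  have Kiff: "z \<in> K \<rho> \<longleftrightarrow> norm (z + - c) \<le> \<rho> \<and> 0 \<le> snd z" for z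
    unfolding nd K_def by (simp add: c_def)
  have ns: "\<bar>snd z\<bar> \<le> norm (z + - c)" for z
    using norm_snd_le[of "snd (z + - c)" "fst (z + - c)"]
    unfolding prod.collapse by (simp add: c_def del: add_uminus_conv_diff)
  have "compact (K \<rho>)"
    unfolding K_def
    by (intro compact_Int_closed compact_cball closed_Collect_le continuous_intros)
  \<comment> \<open>\<open>B\<close> is harmonic because \<open>n\<close> is the dimension, and \<open>B \<ge> 1\<close> on the spherical part because the
     root dominates the loss \<open>n y\<^sup>2 / \<rho>\<^sup>2\<close> of the quadratic term.\<close>
  have key: "- f z - C * B z \<le> \<eta> * (\<rho> + \<rho>\<^sup>2)" if \<eta>: "\<eta> > 0" and "z \<in> K \<rho>" for \<eta> z
  proof -
    \<comment> \<open>Of the two perturbations, the quadratic one makes \<open>v\<close> strictly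
      subharmonic and the linear one tilts \<open>v\<close> upward at the Neumann side; together
      they cost at most \<open>\<eta> * (\<rho> + \<rho>\<^sup>2)\<close>.\<close>
    define v where "v z = - 1 * f z + (- C) * B z + (\<eta> * (z \<bullet> u) + \<eta> * (z \<bullet> u)\<^sup>2)" for z
    have "continuous_on (K \<rho>) v"
      unfolding v_def B_def by (intro continuous_intros cont)
    moreover have "K \<rho> \<noteq> {}" using that(2) by blast
    ultimately obtain m where m: "m \<in> K \<rho>" "\<And>z. z \<in> K \<rho> \<Longrightarrow> v z \<le> v m"
      using continuous_attains_sup[OF \<open>compact (K \<rho>)\<close>] by blast
    have mc: "norm (m + - c) \<le> \<rho>" "0 \<le> snd m" "snd m \<le> \<rho>"
      using m(1) ns[of m] by (auto simp: Kiff)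
    have me: "\<eta> * (m \<bullet> u) + \<eta> * (m \<bullet> u)\<^sup>2 \<le> \<eta> * (\<rho> + \<rho>\<^sup>2)"
      unfolding zu distrib_left[symmetric]
      using mc \<eta> by (intro mult_left_mono add_mono power_mono) auto
    have "v m \<le> \<eta> * (\<rho> + \<rho>\<^sup>2)"
    proof -
      consider "snd m = 0" "0 \<le> (fst m - x0) \<bullet> e"
        | "norm (m + - c) = \<rho>"
        | "snd m = 0" "(fst m - x0) \<bullet> e < 0" "norm (m + - c) < \<rho>"
        | "0 < snd m" "norm (m + - c) < \<rho>"
        using mc by force
      then show ?thesis
      proof cases
        case 1
        then have "0 \<le> f m" using pos[of "fst m"] m(1) by (cases m) auto
        moreover have "0 \<le> B m"
          using 1 \<rho> n1 slit_root_nonneg[of e] by (auto simp: B_def zu)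
        ultimately have "0 \<le> f m" "0 \<le> C * B m" using C by auto
        then show ?thesis unfolding v_def using me by linarith
      next
        case 2
        have "snd m / (2 * sqrt \<rho>) \<le> slit_root e (m + - c)"
          using slit_root_ge[OF e _ \<rho>, of "m + - c"] mc by (simp add: c_def)
        then have "2 * n / sqrt \<rho> * (snd m / (2 * sqrt \<rho>)) \<le> 2 * n / sqrt \<rho> * slit_root e (m + - c)"
          using n1 \<rho> by (intro mult_left_mono) auto
        then have "n * (snd m / \<rho>) \<le> 2 * n / sqrt \<rho> * slit_root e (m + - c)"
          using \<rho> by (simp add: field_simps)
        moreover have "1 / \<rho>\<^sup>2 * ((norm (m + - c))\<^sup>2 - n * (m \<bullet> u)\<^sup>2) = 1 - n * (snd m / \<rho>)\<^sup>2"
          using 2 \<rho> by (simp add: zu field_simps)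
        moreover have "n * (snd m / \<rho>)\<^sup>2 \<le> n * (snd m / \<rho>)"
        proof (rule mult_left_mono)
          have "0 \<le> snd m / \<rho>" "snd m / \<rho> \<le> 1" using mc \<rho> by auto
          then show "(snd m / \<rho>)\<^sup>2 \<le> snd m / \<rho>" unfolding power2_eq_square by (rule mult_left_le[rotated])
        qed (use n1 in simp)
        ultimately have "1 \<le> B m" by (simp add: B_def)
        then have "C \<le> C * B m" using C by (simp add: mult_left_le[of 1] mult_le_cancel_left1)
        then show ?thesis using me bound[OF m(1)] by (simp add: v_def)
      next
        case 3
        \<comment> \<open>Neumann side: \<open>f\<close> does not increase with \<open>y\<close> and \<open>B\<close> grows only quadratically, so
           the term \<open>\<eta> y\<close> excludes a maximum.\<close>
        define a where "a = - ((fst m - x0) \<bullet> e)"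
        have a: "a > 0" using 3 by (simp add: a_def)
        define k where "k = 1 / (8 * a * sqrt a)"
        define M where "M = C * (2 * n / sqrt \<rho>) * k"
        have M: "M \<ge> 0" using C n1 \<rho> a by (simp add: M_def k_def)
        \<comment> \<open>A height small enough to stay in the half ball and to have
          \<open>M * y\<^sup>2 \<le> \<eta> * y\<close>, where \<open>M\<close> bounds the quadratic
          growth of \<open>C * B\<close>. The summand 1 keeps the quotient defined when
          \<open>M = 0\<close>.\<close>
        define y where "y = min ((\<rho> - norm (m + - c)) / 2) (\<eta> / (M + 1))"
        have y: "0 < y" "y \<le> (\<rho> - norm (m + - c)) / 2" "y \<le> \<eta> / (M + 1)"
          unfolding y_def using 3 \<eta> M by (simp, intro min.cobounded1, intro min.cobounded2)
        let ?z = "(fst m, y)"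
        have m0: "m = (fst m, 0)" using 3 by (cases m) auto
        have zK: "?z \<in> K \<rho>"
        proof -
          have "?z + - c = (m + - c) + (0, y)" using m0 by (simp add: c_def prod_eq_iff)
          then have "norm (?z + - c) \<le> norm (m + - c) + norm ((0, y) :: (real^'m) \<times> real)"
            by (metis norm_triangle_ineq)
          then show ?thesis using y 3 by (simp add: Kiff)
        qed
        have "slit_root e (?z + - c) \<le> slit_root e (m + - c) + k * y\<^sup>2"
          using slit_root_growth[OF a, of y] 3 a by (simp add: slit_root_def c_def k_def a_def power2_eq_square)
        then have "2 * n / sqrt \<rho> * slit_root e (?z + - c) \<le>
            2 * n / sqrt \<rho> * (slit_root e (m + - c) + k * y\<^sup>2)"
          using n1 \<rho> by (intro mult_left_mono) auto
        moreover have "1 / \<rho>\<^sup>2 * ((norm (?z + - c))\<^sup>2 - n * (?z \<bullet> u)\<^sup>2) \<le>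
            1 / \<rho>\<^sup>2 * ((norm (m + - c))\<^sup>2 - n * (m \<bullet> u)\<^sup>2)"
        proof (rule mult_left_mono)
          have "(norm (?z + - c))\<^sup>2 = (norm (m + - c))\<^sup>2 + y\<^sup>2"
          proof -
            have "?z + - c = (fst m - x0, y)" "m + - c = (fst m - x0, 0)"
              using 3 by (auto simp: c_def prod_eq_iff)
            then show ?thesis by (simp only: norm_Pair) simp
          qed
          moreover have "y\<^sup>2 \<le> n * y\<^sup>2" using n1 by (simp add: mult_le_cancel_right1)
          ultimately show "(norm (?z + - c))\<^sup>2 - n * (?z \<bullet> u)\<^sup>2 \<le> (norm (m + - c))\<^sup>2 - n * (m \<bullet> u)\<^sup>2"
            using 3 by (simp add: zu)
        qed simp
        ultimately have "B ?z \<le> B m + 2 * n / sqrt \<rho> * (k * y\<^sup>2)"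
          unfolding B_def by (simp add: distrib_left)
        then have "C * B ?z \<le> C * (B m + 2 * n / sqrt \<rho> * (k * y\<^sup>2))"
          using C by (intro mult_left_mono)
        also have "\<dots> = C * B m + M * y\<^sup>2" by (simp add: M_def algebra_simps)
        finally have "C * B ?z \<le> C * B m + M * y\<^sup>2" .
        moreover have "f ?z \<le> f m" using mono[OF zK] m0 by simp
        moreover have "v ?z \<le> v m" by (rule m(2)[OF zK])
        ultimately have "\<eta> * y + \<eta> * y\<^sup>2 \<le> M * y\<^sup>2"
          using 3 by (simp add: v_def zu)
        moreover have "M * y\<^sup>2 \<le> \<eta> * y"
        proof -
          have "M * y \<le> (M + 1) * y" using y by (simp add: algebra_simps)
          also have "\<dots> \<le> \<eta>" using y(3) M by (simp add: field_simps)
          finally show ?thesis using y(1) by (simp add: power2_eq_square)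
        qed
        ultimately have "\<eta> * y\<^sup>2 \<le> 0" by linarith
        then show ?thesis using \<eta> y(1) by (simp add: mult_le_0_iff)
      next
        case 4
        have "dist c m < \<rho>" using 4(2) unfolding nd .
        then have "has_lap f m 0" using harm[OF m(1)] 4(1) unfolding c_def by blast
        then have "has_lap v m (- 1 * 0 + (- C) * (2 * n / sqrt \<rho> * 0 +
            1 / \<rho>\<^sup>2 * (2 * real DIM((real^'m) \<times> real) - n * (2 * (norm u)\<^sup>2))) +
            (\<eta> * 0 + \<eta> * (2 * (norm u)\<^sup>2)))"
          unfolding v_def B_def
          by (intro has_lap_add has_lap_cmult has_lap_diff
            has_lap_translate[where f = "\<lambda>z. (norm z)\<^sup>2"]
            has_lap_translate[where f = "slit_root e"]
            has_lap_norm_power2 has_lap_inner has_lap_inner_power2 has_lap_slit_root)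
            (use 4 e in \<open>auto simp: c_def\<close>)
        then have "has_lap v m (2 * \<eta>)" by (simp add: n_def u_def norm_Pair mult.commute)
        moreover have "\<forall>\<^sub>F z in nhds m. v z \<le> v m"
        proof -
          have "open ({z. norm (z + - c) < \<rho>} \<inter> {z. 0 < snd z})"
            by (intro open_Int open_Collect_less continuous_intros)
          then have "\<forall>\<^sub>F z in nhds m. z \<in> {z. norm (z + - c) < \<rho>} \<inter> {z. 0 < snd z}"
            using 4 by (intro eventually_nhds_in_open) auto
          then show ?thesis
            by (rule eventually_mono) (rule m(2), auto simp: Kiff)
        qed
        ultimately have "2 * \<eta> \<le> 0" by (rule has_lap_at_max)
        then show ?thesis using \<eta> by simp
      qed
    qed
    moreover have "v z \<le> v m" using m(2) that by simp
    moreover have "- f z - C * B z \<le> v z"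
      using \<eta> that(2) by (simp add: v_def zu Kiff)
    ultimately show ?thesis by linarith
  qed
  have "- f p - C * B p \<le> 0"
  proof (rule field_le_epsilon)
    fix d :: real assume "d > 0"
    moreover have "\<rho> + \<rho>\<^sup>2 > 0" using \<rho> by (simp add: add_pos_pos)
    ultimately show "- f p - C * B p \<le> 0 + d"
      using key[of "d / (\<rho> + \<rho>\<^sup>2)", OF _ p] by simp
  qed
  moreover have "B p \<le> (2 * n + 1) * sqrt (norm (p + - c) / \<rho>)"
  proof -
    let ?q = "norm (p + - c) / \<rho>"
    have q: "0 \<le> ?q" "?q \<le> 1" using p \<rho> by (auto simp: Kiff)
    have "1 / \<rho>\<^sup>2 * ((norm (p + - c))\<^sup>2 - n * (p \<bullet> u)\<^sup>2) \<le> 1 / \<rho>\<^sup>2 * (norm (p + - c))\<^sup>2"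
      using n1 by (intro mult_left_mono) auto
    also have "\<dots> = ?q\<^sup>2" by (simp add: power_divide)
    also have "\<dots> \<le> sqrt ?q"
    proof -
      have "?q\<^sup>2 \<le> ?q" unfolding power2_eq_square using q by (rule mult_left_le[rotated])
      also have "?q \<le> sqrt ?q" using q \<open>?q\<^sup>2 \<le> ?q\<close> by (intro real_le_rsqrt)
      finally show ?thesis .
    qed
    finally have "1 / \<rho>\<^sup>2 * ((norm (p + - c))\<^sup>2 - n * (p \<bullet> u)\<^sup>2) \<le> sqrt ?q" .
    moreover have "2 * n / sqrt \<rho> * slit_root e (p + - c) \<le> 2 * n / sqrt \<rho> * sqrt (norm (p + - c))"
      using slit_root_le[OF e] n1 \<rho> by (intro mult_left_mono) auto
    moreover have "2 * n / sqrt \<rho> * sqrt (norm (p + - c)) = 2 * n * sqrt ?q"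
      by (simp add: real_sqrt_divide)
    ultimately have "B p \<le> 2 * n * sqrt ?q + sqrt ?q" unfolding B_def by linarith
    then show ?thesis by (simp add: distrib_right)
  qed
  then have "C * B p \<le> C * ((2 * n + 1) * sqrt (norm (p + - c) / \<rho>))"
    using C by (rule mult_left_mono)
  moreover have "dist (x0, 0) p = norm (p + - c)" unfolding nd by (simp only: c_def)
  ultimately show ?thesis by (simp add: n_def mult.assoc)
qed

subsection \<open>Monotonicity and bounds for the normal derivative\<close>

lemma deriv_line:
  assumes "(f has_derivative f') (at (p + t *\<^sub>R v))"
  shows "((\<lambda>s. f (p + s *\<^sub>R v)) has_real_derivative f' v) (at t)"
proof -
  interpret bounded_linear f' using assms by (rule has_derivative_bounded_linear)
  have "((\<lambda>s. f (p + s *\<^sub>R v)) has_derivative (\<lambda>h. f' (h *\<^sub>R v))) (at t)"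
    by (rule has_derivative_compose[where f = "\<lambda>s. p + s *\<^sub>R v" and g = f and g' = f'])
      (use assms in \<open>auto intro!: derivative_eq_intros\<close>)
  then show ?thesis
    by (rule has_derivative_imp_has_field_derivative) (simp add: scaleR)
qed

lemma partial_eq:
  assumes "(f has_derivative f') (at p)"
  shows "partial v f p = f' v"
  unfolding partial_def using deriv_line[of f f' p 0 v] assms by (auto intro: DERIV_imp_deriv)

lemma deriv_line_partial:
  assumes "f differentiable (at (p + t *\<^sub>R v))"
  shows "((\<lambda>s. f (p + s *\<^sub>R v)) has_real_derivative partial v f (p + t *\<^sub>R v)) (at t)"
  using assms unfolding differentiable_def by (metis deriv_line partial_eq)

context
  fixes f :: "'a::euclidean_space \<Rightarrow> real" and S
  assumes C2: "C2_on S f" and S: "open S"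
begin

lemma C2_differentiable: "q \<in> S \<Longrightarrow> f differentiable (at q)"
  using C2 S unfolding C2_on_def C1_on_def differentiable_on_def by (metis at_within_open)

text \<open>\<open>C2_on\<close> speaks of coordinate directions, tangential convexity of all unit
  tangential ones. Near \<open>q\<close> the partial derivative along \<open>v\<close> is a linear
  combination of the coordinate ones, which are differentiable.\<close>

lemma C2_partial_differentiable:
  assumes "q \<in> S"
  shows "partial v f differentiable (at q)"
proof -
  have "(\<lambda>p. \<Sum>i\<in>Basis. (v \<bullet> i) * partial i f p) differentiable (at q)"
  proof (intro differentiable_sum differentiable_mult differentiable_const ballI)
    show "partial i f differentiable (at q)" if "i \<in> Basis" for i
      using C2 S that assms unfolding C2_on_def C1_on_def differentiable_on_def
      by (metis at_within_open)
  qed simp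
  then obtain D where "((\<lambda>p. \<Sum>i\<in>Basis. (v \<bullet> i) * partial i f p) has_derivative D) (at q)"
    unfolding differentiable_def by blast
  then have "(partial v f has_derivative D) (at q)"
  proof (rule has_derivative_transform_within_open[OF _ S assms])
    fix p assume "p \<in> S"
    then obtain f' where f': "(f has_derivative f') (at p)"
      using C2_differentiable unfolding differentiable_def by blast
    interpret bounded_linear f' using f' by (rule has_derivative_bounded_linear)
    have "f' v = f' (\<Sum>i\<in>Basis. (v \<bullet> i) *\<^sub>R i)" by (simp add: euclidean_representation)
    also have "\<dots> = (\<Sum>i\<in>Basis. (v \<bullet> i) * f' i)" by (simp add: sum scaleR)
    finally show "(\<Sum>i\<in>Basis. (v \<bullet> i) * partial i f p) = partial v f p"
      by (simp add: partial_eq[OF f'])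
  qed
  then show ?thesis unfolding differentiable_def by blast
qed

lemma C2_has_lap:
  assumes "p \<in> S"
  shows "has_lap f p (laplacian f p)"
  unfolding has_lap_def
proof (intro exI[of _ "\<lambda>i. partial i (partial i f) p"] conjI ballI)
  fix i :: 'a
  show "has_dd (\<lambda>t. f (p + t *\<^sub>R i)) (partial i (partial i f) p)"
    unfolding has_dd_def
  proof (intro exI[of _ "\<lambda>t. partial i f (p + t *\<^sub>R i)"] conjI)
    have "filterlim (\<lambda>t. p + t *\<^sub>R i) (nhds (p + 0 *\<^sub>R i)) (nhds 0)"
      by (intro tendsto_intros filterlim_ident)
    then have "\<forall>\<^sub>F t in nhds 0. p + t *\<^sub>R i \<in> S"
      using S assms by (auto elim!: topological_tendstoD)
    then show "\<forall>\<^sub>F t in nhds 0. ((\<lambda>t. f (p + t *\<^sub>R i)) has_real_derivative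
        partial i f (p + t *\<^sub>R i)) (at t)"
      by eventually_elim (intro deriv_line_partial C2_differentiable)
    show "((\<lambda>t. partial i f (p + t *\<^sub>R i)) has_real_derivative partial i (partial i f) p) (at 0)"
      using deriv_line_partial[of "partial i f" p 0 i] C2_partial_differentiable assms by simp
  qed
qed (simp add: laplacian_def)

end

abbreviation closed_half_ball :: "real \<Rightarrow> ((real^'m) \<times> real) set" where
  "closed_half_ball r \<equiv> cball 0 r \<inter> {p. 0 \<le> snd p}"

text \<open>The closure of an intersection of two open convex sets with a common point is the
  intersection of their closures. Continuity on the abstract closure thereby becomes continuity on
  an explicit set.\<close>

lemma closed_half_ball_subset:
  "(closed_half_ball 1 :: ((real^'m) \<times> real) set) \<subseteq> closure (upper_half_ball 1)"
proof -
  let ?u = "(0, 1) :: (real^'m) \<times> real"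
  have u0: "?u \<noteq> 0" by (simp add: zero_prod_def)
  have H: "{p. 0 < snd p} = {p. 0 < ?u \<bullet> p}" "{p. 0 \<le> snd p} = {p. 0 \<le> ?u \<bullet> p}"
    by (auto simp: inner_prod_def)
  have ne: "ball (0 :: (real^'m) \<times> real) 1 \<inter> {p. 0 < ?u \<bullet> p} \<noteq> {}"
  proof -
    have "(0, 1/2) \<in> ball (0 :: (real^'m) \<times> real) 1 \<inter> {p. 0 < ?u \<bullet> p}"
      by (simp add: norm_Pair inner_prod_def)
    then show ?thesis by blast
  qed
  have "closure (ball 0 1 \<inter> {p. 0 < ?u \<bullet> p}) = closure (ball 0 1) \<inter> closure {p. 0 < ?u \<bullet> p}"
    by (intro closure_Int_convex convex_ball convex_halfspace_gt)
      (use ne in \<open>simp add: rel_interior_open open_halfspace_gt\<close>)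
  then show ?thesis using closure_halfspace_gt[of ?u 0] u0 by (simp add: upper_half_ball_def H)
qed

lemma norm_pair_less:
  fixes a b r y :: real
  shows "\<bar>y\<bar> < b \<Longrightarrow> norm x \<le> a \<Longrightarrow> a\<^sup>2 + b\<^sup>2 \<le> r\<^sup>2 \<Longrightarrow> 0 \<le> r \<Longrightarrow> norm (x, y) < r"
proof -
  assume a: "\<bar>y\<bar> < b" "norm x \<le> a" "a\<^sup>2 + b\<^sup>2 \<le> r\<^sup>2" "0 \<le> r"
  have "(norm x)\<^sup>2 \<le> a\<^sup>2" using a by (intro power_mono) auto
  moreover have "y\<^sup>2 < b\<^sup>2" using a by (metis abs_ge_zero power2_abs power_strict_mono zero_less_numeral)
  ultimately have "(norm x)\<^sup>2 + y\<^sup>2 < r\<^sup>2" using a by linarith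
  then show ?thesis using a by (simp add: norm_Pair real_less_lsqrt)
qed

lemma norm_pair_le: "norm (x, y::real) \<le> norm x + \<bar>y\<bar>"
  using norm_Pair_le[of x y] by simp

section \<open>Consequences of tangential convexity\<close>

text \<open>\<open>W\<close> fixes one continuous extension of the normal derivative to the flat
  part, because \<open>partial\<close> is two-sided there and would depend on values of
  \<open>u\<close> below it. The constants of the estimates are built from \<open>M\<close> and
  \<open>n\<close> alone, which makes them visibly independent of \<open>\<epsilon>\<close>.\<close>

locale convex_solution =
  fixes \<epsilon> M n :: real and \<phi> u W :: "(real^'m) \<times> real \<Rightarrow> real"
  assumes eps: "\<epsilon> > 0" and sol: "penalized_solution \<epsilon> \<phi> u" and conv: "tangentially_convex u"
    and contW: "continuous_on (upper_half_ball 1 \<union> flat_ball 1) W"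
    and W: "\<And>p. p \<in> upper_half_ball 1 \<Longrightarrow> W p = partial (0, 1) u p"
    and M: "\<And>p. p \<in> sphere 0 1 \<Longrightarrow> \<bar>\<phi> p\<bar> \<le> M" and M0: "0 \<le> M"
    and dim_eq: "n = real DIM((real^'m) \<times> real)"
begin

abbreviation "U \<equiv> upper_half_ball 1 :: ((real^'m) \<times> real) set"

lemma U_iff: "p \<in> U \<longleftrightarrow> norm p < 1 \<and> 0 < snd p"
  by (auto simp: upper_half_ball_def)

lemma UF_iff: "p \<in> U \<union> flat_ball 1 \<longleftrightarrow> norm p < 1 \<and> 0 \<le> snd p"
  by (auto simp: upper_half_ball_def flat_ball_def)

lemma open_U: "open U"
  unfolding upper_half_ball_def by (intro open_Int open_ball open_Collect_less continuous_intros)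

lemma C2u: "C2_on U u" and sphere_eq: "\<And>p. norm p = 1 \<Longrightarrow> 0 < snd p \<Longrightarrow> u p = \<phi> p"
  and flat_derivative: "\<And>x. norm x < 1 \<Longrightarrow>
    ((\<lambda>y. u (x, y)) has_real_derivative penalty \<epsilon> (u (x, 0))) (at_right 0)"
  using sol unfolding penalized_solution_def by (auto simp: flat_ball_def)

lemma cont_u: "continuous_on (closed_half_ball 1) u"
  using sol closed_half_ball_subset continuous_on_subset unfolding penalized_solution_def by blast

lemma has_lap_u: "p \<in> U \<Longrightarrow> has_lap u p 0"
  using C2_has_lap[OF C2u open_U, of p] sol unfolding penalized_solution_def by simp

lemmas du = C2_differentiable[OF C2u open_U]
lemmas ddu = C2_partial_differentiable[OF C2u open_U]

text \<open>The closed half ball is star-shaped about the interior point \<open>(0, 1/2)\<close>,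
  and any motion towards that point enters the open half ball at once. This carries inequalities
  from the interior to the closure.\<close>

lemma tendsto_into_half_ball:
  fixes P :: "(real^'m) \<times> real"
  assumes "P \<in> closed_half_ball 1"
  defines "\<gamma> t \<equiv> P + t *\<^sub>R ((0, 1/2) - P)"
  shows "\<forall>\<^sub>F t in at_right 0. \<gamma> t \<in> U" "((\<lambda>t. u (\<gamma> t)) \<longlongrightarrow> u P) (at_right 0)"
proof -
  have "\<forall>\<^sub>F t in at_right (0::real). 0 < t \<and> t < 1"
    using eventually_at_right_real[of 0 1] by (auto elim: eventually_mono)
  then show ev: "\<forall>\<^sub>F t in at_right 0. \<gamma> t \<in> U"
  proof eventually_elim
    case (elim t)
    have "\<gamma> t = (1 - t) *\<^sub>R P + t *\<^sub>R (0, 1/2)" by (simp add: \<gamma>_def algebra_simps)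
    then have "norm (\<gamma> t) \<le> norm ((1 - t) *\<^sub>R P) + norm (t *\<^sub>R (0 :: real^'m, 1/2 :: real))"
      by (metis norm_triangle_ineq)
    also have "\<dots> = (1 - t) * norm P + t * (1/2)" using elim by (simp add: norm_Pair)
    also have "\<dots> \<le> (1 - t) * 1 + t * (1/2)" using assms(1) elim by (intro add_mono mult_left_mono) auto
    also have "\<dots> < 1" using elim by simp
    finally have "norm (\<gamma> t) < 1" .
    moreover have "0 < snd (\<gamma> t)"
    proof -
      have "snd (\<gamma> t) = (1 - t) * snd P + t * (1/2)" by (simp add: \<gamma>_def algebra_simps)
      moreover have "0 \<le> (1 - t) * snd P" using assms(1) elim by auto
      ultimately show ?thesis using elim by linarith
    qed
    ultimately show ?case by (simp add: U_iff)
  qed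
  have "(\<gamma> \<longlongrightarrow> P + 0 *\<^sub>R ((0, 1/2) - P)) (at_right 0)"
    unfolding \<gamma>_def by (intro tendsto_intros)
  then show "((\<lambda>t. u (\<gamma> t)) \<longlongrightarrow> u P) (at_right 0)"
    using assms(1) ev by (intro continuous_on_tendsto_compose[OF cont_u])
      (auto elim!: eventually_mono simp: U_iff)
qed

lemma convex_horizontal_open:
  assumes a: "(a, y) \<in> U" and b: "(b, y) \<in> U" and l: "0 \<le> l" "l \<le> 1"
  shows "u ((1 - l) *\<^sub>R a + l *\<^sub>R b, y) \<le> (1 - l) * u (a, y) + l * u (b, y)"
proof (cases "a = b")
  case True
  then show ?thesis by (simp add: algebra_simps)
next
  case False
  \<comment> \<open>Arc length parametrisation, since \<open>tangentially_convex\<close> is stated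
    for unit vectors.\<close>
  define L where "L = norm (b - a)"
  have L: "L > 0" using False by (simp add: L_def)
  define e where "e = (b - a) /\<^sub>R L"
  have e: "norm e = 1" using L by (simp add: e_def L_def)
  define \<gamma> where "\<gamma> t = (a, y) + t *\<^sub>R (e, 0)" for t
  have \<gamma>U: "\<gamma> t \<in> U" if "t \<in> {0..L}" for t
  proof -
    have "\<gamma> t = (1 - t / L) *\<^sub>R (a, y) + (t / L) *\<^sub>R (b, y)"
      by (simp add: \<gamma>_def e_def algebra_simps divide_inverse)
    moreover have "convex U" unfolding upper_half_ball_def
      using convex_halfspace_gt[of 0 "(0, 1) :: (real^'m) \<times> real"]
      by (intro convex_Int convex_ball) (simp add: inner_prod_def)
    ultimately show ?thesis
      using convexD_alt[OF \<open>convex U\<close> a b, of "t / L"] that L by simp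
  qed
  have "convex_on {0..L} (\<lambda>t. u (\<gamma> t))"
  proof (rule f''_ge0_imp_convex[where f' = "\<lambda>t. partial (e, 0) u (\<gamma> t)"
        and f'' = "\<lambda>t. partial (e, 0) (partial (e, 0) u) (\<gamma> t)"])
    fix t assume t: "t \<in> {0..L}"
    show "((\<lambda>t. u (\<gamma> t)) has_real_derivative partial (e, 0) u (\<gamma> t)) (at t)"
      unfolding \<gamma>_def by (rule deriv_line_partial[OF du]) (use \<gamma>U[OF t] in \<open>simp add: \<gamma>_def\<close>)
    show "((\<lambda>t. partial (e, 0) u (\<gamma> t)) has_real_derivative
        partial (e, 0) (partial (e, 0) u) (\<gamma> t)) (at t)"
      unfolding \<gamma>_def by (rule deriv_line_partial[OF ddu]) (use \<gamma>U[OF t] in \<open>simp add: \<gamma>_def\<close>)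
    show "0 \<le> partial (e, 0) (partial (e, 0) u) (\<gamma> t)"
      using conv e \<gamma>U[OF t] unfolding tangentially_convex_def by blast
  qed auto
  from convex_onD[OF this, of l 0 L]
  have "u (\<gamma> (l * L)) \<le> (1 - l) * u (\<gamma> 0) + l * u (\<gamma> L)" using l L by simp
  moreover have Le: "L *\<^sub>R e = b - a" using L by (simp add: e_def)
  then have "\<gamma> 0 = (a, y)" "\<gamma> L = (b, y)" by (simp_all add: \<gamma>_def)
  moreover have "(l * L) *\<^sub>R e = l *\<^sub>R (b - a)" by (simp only: Le flip: scaleR_scaleR)
  then have "\<gamma> (l * L) = ((1 - l) *\<^sub>R a + l *\<^sub>R b, y)"
    by (simp add: \<gamma>_def algebra_simps)
  ultimately show ?thesis by simp
qed

text \<open>Contracting both endpoints towards \<open>(0, 1/2)\<close> by the same factor keeps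
  their heights equal, so the interior version applies to the contracted chord; continuity gives the
  limit.\<close>

lemma convex_horizontal:
  assumes a: "(a, y) \<in> closed_half_ball 1" and b: "(b, y) \<in> closed_half_ball 1"
    and l: "0 \<le> l" "l \<le> 1"
  shows "u ((1 - l) *\<^sub>R a + l *\<^sub>R b, y) \<le> (1 - l) * u (a, y) + l * u (b, y)"
proof -
  let ?c = "(1 - l) *\<^sub>R a + l *\<^sub>R b"
  define \<gamma> where "\<gamma> P t = P + t *\<^sub>R ((0, 1/2) - P)" for P :: "(real^'m) \<times> real" and t
  have "convex (closed_half_ball 1 :: ((real^'m) \<times> real) set)"
    using convex_halfspace_ge[of 0 "(0, 1) :: (real^'m) \<times> real"]
    by (intro convex_Int convex_cball) (simp add: inner_prod_def)
  from convexD_alt[OF this a b l]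
  have c: "(?c, y) \<in> closed_half_ball 1" by (simp add: algebra_simps)
  have ev: "\<forall>\<^sub>F t in at_right 0. u (\<gamma> (?c, y) t) \<le> (1 - l) * u (\<gamma> (a, y) t) + l * u (\<gamma> (b, y) t)"
    using tendsto_into_half_ball(1)[OF a] tendsto_into_half_ball(1)[OF b]
  proof eventually_elim
    case (elim t)
    have eq: "\<gamma> (z, y) t = ((1 - t) *\<^sub>R z, (1 - t) * y + t / 2)" for z
      by (simp add: \<gamma>_def algebra_simps)
    have "(1 - t) *\<^sub>R ?c = (1 - l) *\<^sub>R ((1 - t) *\<^sub>R a) + l *\<^sub>R ((1 - t) *\<^sub>R b)"
      by (simp add: algebra_simps)
    then show ?case
      using convex_horizontal_open[of "(1 - t) *\<^sub>R a" "(1 - t) * y + t / 2" "(1 - t) *\<^sub>R b" l] elim l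
      unfolding \<gamma>_def[symmetric] eq by simp
  qed
  have lim: "((\<lambda>t. u (\<gamma> P t)) \<longlongrightarrow> u P) (at_right 0)" if "P \<in> closed_half_ball 1" for P
    using tendsto_into_half_ball(2)[OF that] by (simp add: \<gamma>_def)
  have "((\<lambda>t. (1 - l) * u (\<gamma> (a, y) t) + l * u (\<gamma> (b, y) t)) \<longlongrightarrow>
      (1 - l) * u (a, y) + l * u (b, y)) (at_right 0)"
    by (intro tendsto_intros lim a b)
  then show ?thesis
    using ev tendsto_le[OF trivial_limit_at_right_real _ lim[OF c]] by blast
qed

text \<open>The horizontal chord through the point ends on the upper part of the sphere, where
  \<open>u\<close> equals \<open>\<phi>\<close>, and a convex function on a chord is bounded by its
  end values. Nothing about the flat part enters.\<close>

lemma u_le_M: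
  assumes "(x, y) \<in> U"
  shows "u (x, y) \<le> M"
proof -
  define R where "R = sqrt (1 - y\<^sup>2)"
  have y: "(norm x)\<^sup>2 + y\<^sup>2 < 1" "0 < y" using assms by (auto simp: U_iff norm_Pair)
  have y1: "y\<^sup>2 < 1" using y by (smt (verit) zero_le_power2)
  then have R: "R > 0" "R\<^sup>2 = 1 - y\<^sup>2" by (auto simp: R_def)
  have xR: "norm x \<le> R" unfolding R_def using y by (intro real_le_rsqrt) simp
  obtain e :: "real^'m" where e: "norm e = 1" "x = norm x *\<^sub>R e"
  proof (cases "x = 0")
    case True
    obtain e :: "real^'m" where "e \<in> Basis" using nonempty_Basis by blast
    then show ?thesis using that[of e] True by simp
  next
    case False
    then show ?thesis using that[of "x /\<^sub>R norm x"] by simp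
  qed
  have end_le: "u (s *\<^sub>R e, y) \<le> M" "(s *\<^sub>R e, y) \<in> closed_half_ball 1" if "\<bar>s\<bar> = R" for s
  proof -
    have s: "s\<^sup>2 = 1 - y\<^sup>2" using that R by (metis power2_abs)
    then have n1: "norm (s *\<^sub>R e, y) = 1" using e by (simp add: norm_Pair power_mult_distrib)
    then show "(s *\<^sub>R e, y) \<in> closed_half_ball 1" using y by simp
    show "u (s *\<^sub>R e, y) \<le> M" using sphere_eq[of "(s *\<^sub>R e, y)"] M[of "(s *\<^sub>R e, y)"] n1 y by simp
  qed
  define l where "l = (norm x / R + 1) / 2"
  have l: "0 \<le> l" "l \<le> 1" using xR R by (auto simp: l_def)
  have "(1 - l) *\<^sub>R ((- R) *\<^sub>R e) + l *\<^sub>R (R *\<^sub>R e) = ((2 * l - 1) * R) *\<^sub>R e"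
    by (simp only: scaleR_scaleR flip: scaleR_left_distrib) (simp add: algebra_simps)
  also have "(2 * l - 1) * R = norm x"
  proof -
    have "2 * l - 1 = norm x / R" using R by (simp add: l_def field_simps)
    then show ?thesis using R by simp
  qed
  finally have "(1 - l) *\<^sub>R ((- R) *\<^sub>R e) + l *\<^sub>R (R *\<^sub>R e) = x" using e by simp
  then have "u (x, y) \<le> (1 - l) * u ((- R) *\<^sub>R e, y) + l * u (R *\<^sub>R e, y)"
    using convex_horizontal[of "(- R) *\<^sub>R e" y "R *\<^sub>R e" l] end_le(2)[of R] end_le(2)[of "- R"] l R by simp
  also have "\<dots> \<le> (1 - l) * M + l * M"
    using end_le(1)[of R] end_le(1)[of "- R"] l R by (intro add_mono mult_left_mono) auto
  finally show ?thesis by (simp add: algebra_simps)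
qed

lemma du_y:
  assumes "(x, y) \<in> U"
  shows "((\<lambda>y. u (x, y)) has_real_derivative W (x, y)) (at y)"
proof -
  have "((\<lambda>s. u ((x, 0) + s *\<^sub>R (0, 1))) has_real_derivative partial (0, 1) u ((x, 0) + y *\<^sub>R (0, 1))) (at y)"
    by (rule deriv_line_partial[OF du]) (use assms in simp)
  then show ?thesis using W[OF assms] by simp
qed

lemma W_antimono_open:
  assumes "0 < y1" "y1 \<le> y2" "norm (x, y2) < 1"
  shows "W (x, y2) \<le> W (x, y1)"
proof -
  have U: "(x, y) \<in> U" if "y1 \<le> y" "y \<le> y2" for y
  proof -
    have "y\<^sup>2 \<le> y2\<^sup>2" using that assms by (intro power_mono) auto
    then have "norm (x, y) \<le> norm (x, y2)" by (simp add: norm_Pair)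
    then show ?thesis using assms that by (simp add: U_iff)
  qed
  have "partial (0, 1) u (x, y2) \<le> partial (0, 1) u (x, y1)"
  proof (rule DERIV_nonpos_imp_nonincreasing[OF assms(2)])
    fix y assume y: "y1 \<le> y" "y \<le> y2"
    have "((\<lambda>s. partial (0, 1) u ((x, 0) + s *\<^sub>R (0, 1))) has_real_derivative
        partial (0, 1) (partial (0, 1) u) ((x, 0) + y *\<^sub>R (0, 1))) (at y)"
      by (rule deriv_line_partial[OF ddu]) (use U[OF y] in simp)
    moreover have "partial (0, 1) (partial (0, 1) u) (x, y) \<le> 0"
    proof -
      have "0 = laplacian u (x, y)"
        using sol U[OF y] unfolding penalized_solution_def by simp
      also have "\<dots> = (\<Sum>j\<in>Basis. partial (j, 0) (partial (j, 0) u) (x, y)) +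
          partial (0, 1) (partial (0, 1) u) (x, y)"
        unfolding laplacian_def Basis_prod_def
        by (subst sum.union_disjoint) (auto simp: sum.reindex inj_on_def)
      finally have "partial (0, 1) (partial (0, 1) u) (x, y) =
          - (\<Sum>j\<in>Basis. partial (j, 0) (partial (j, 0) u) (x, y))" by simp
      moreover have "0 \<le> (\<Sum>j\<in>Basis. partial (j, 0) (partial (j, 0) u) (x, y))"
        using conv U[OF y] unfolding tangentially_convex_def by (intro sum_nonneg) simp
      ultimately show ?thesis by simp
    qed
    ultimately show "\<exists>D. ((\<lambda>y. partial (0, 1) u (x, y)) has_real_derivative D) (at y) \<and> D \<le> 0"
      by auto
  qed
  then show ?thesis using W U assms by simp
qed

lemma tendsto_vertical:
  assumes "norm (x, y) < 1" "0 \<le> y"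
  shows "((\<lambda>h. W (x, y + h)) \<longlongrightarrow> W (x, y)) (at_right 0)"
proof -
  have lim: "((\<lambda>h. (x, y + h)) \<longlongrightarrow> (x, y + 0)) (at_right 0)"
    by (intro tendsto_intros)
  have "open {p :: (real^'m) \<times> real. norm p < 1}" by (intro open_Collect_less continuous_intros)
  then have "\<forall>\<^sub>F h in at_right 0. norm (x, y + h) < 1"
    using topological_tendstoD[OF lim, of "{p. norm p < 1}"] assms by simp
  moreover have "\<forall>\<^sub>F h in at_right (0::real). 0 < h" by (simp add: eventually_at_right_less)
  ultimately have "\<forall>\<^sub>F h in at_right 0. (x, y + h) \<in> U \<union> flat_ball 1"
    by eventually_elim (use assms in \<open>simp add: UF_iff del: Un_iff\<close>)
  then show ?thesis
    using lim assms by (intro continuous_on_tendsto_compose[OF contW]) (simp_all add: UF_iff del: Un_iff)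
qed

lemma W_antimono:
  assumes "0 \<le> y1" "y1 \<le> y2" "norm (x, y2) < 1"
  shows "W (x, y2) \<le> W (x, y1)"
proof (cases "y1 = 0 \<and> y2 > 0")
  case True
  have "\<forall>\<^sub>F h in at_right (0::real). 0 < h \<and> h < y2"
    using eventually_at_right_real[of 0 y2] True by (auto elim: eventually_mono)
  then have "\<forall>\<^sub>F h in at_right 0. W (x, y2) \<le> W (x, 0 + h)"
    by eventually_elim (use assms in \<open>auto intro!: W_antimono_open\<close>)
  moreover have "norm (x, 0 :: real) < 1"
  proof -
    have "norm (x, 0 :: real) = norm x" by (simp add: norm_Pair)
    then show ?thesis using assms(3) norm_fst_le[of x y2] by linarith
  qed
  ultimately have "W (x, y2) \<le> W (x, 0)"
    by (intro tendsto_lowerbound[OF tendsto_vertical[of x 0]]) auto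
  then show ?thesis using True by simp
next
  case False
  then show ?thesis using W_antimono_open[of y1 y2 x] assms by (cases "y1 = y2") auto
qed

lemma vertical_in:
  fixes y b :: real and x :: "real^'m"
  assumes "0 \<le> y" "y \<le> b" "norm (x, b) < 1"
  shows "norm (x, y) < 1"
proof -
  have "y\<^sup>2 \<le> b\<^sup>2" using assms by (intro power_mono) auto
  then have "norm (x, y) \<le> norm (x, b)" by (simp add: norm_Pair)
  then show ?thesis using assms by simp
qed

lemma cont_vertical:
  assumes "0 \<le> a" "norm (x, b) \<le> 1"
  shows "continuous_on {a..b} (\<lambda>y. u (x, y))"
proof (rule continuous_on_compose2[OF cont_u])
  show "(\<lambda>y. (x, y)) ` {a..b} \<subseteq> closed_half_ball 1"
  proof (rule image_subsetI)
    fix y assume "y \<in> {a..b}"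
    then have y: "a \<le> y" "y \<le> b" by auto
    have "y\<^sup>2 \<le> b\<^sup>2" using assms y by (intro power_mono) auto
    then have "norm (x, y) \<le> norm (x, b)" by (simp add: norm_Pair)
    then have "norm (x, y) \<le> 1" using assms by linarith
    then show "(x, y) \<in> closed_half_ball 1" using assms y by simp
  qed
qed (intro continuous_intros)

text \<open>Concavity in \<open>y\<close> traps the slope of a vertical chord between
  \<open>W\<close> at its two ends. The lower end may be flat, since derivatives are taken only
  strictly inside the chord.\<close>

lemma difference_bounds:
  assumes "0 \<le> y" "0 < h" "norm (x, y + h) < 1"
  shows "h * W (x, y + h) \<le> u (x, y + h) - u (x, y)" "u (x, y + h) - u (x, y) \<le> h * W (x, y)"
proof -
  have U: "(x, z) \<in> U" if "y < z" "z \<le> y + h" for z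
    using vertical_in[of z "y + h" x] assms that by (simp add: U_iff)
  have "u (x, y) - y * W (x, y + h) \<le> u (x, y + h) - (y + h) * W (x, y + h)"
  proof (rule DERIV_nonneg_imp_increasing_open[where f = "\<lambda>z. u (x, z) - z * W (x, y + h)"])
    fix z assume z: "y < z" "z < y + h"
    show "\<exists>D. ((\<lambda>z. u (x, z) - z * W (x, y + h)) has_real_derivative D) (at z) \<and> 0 \<le> D"
      using U[of z] z assms W_antimono[of z "y + h" x]
      by (intro exI[of _ "W (x, z) - W (x, y + h)"] conjI) (auto intro!: derivative_eq_intros du_y)
  qed (use assms in \<open>auto intro!: continuous_intros cont_vertical\<close>)
  then show "h * W (x, y + h) \<le> u (x, y + h) - u (x, y)" by (simp add: algebra_simps)
  have "u (x, y) - y * W (x, y) \<ge> u (x, y + h) - (y + h) * W (x, y)"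
  proof (rule DERIV_nonpos_imp_decreasing_open[where f = "\<lambda>z. u (x, z) - z * W (x, y)"])
    fix z assume z: "y < z" "z < y + h"
    have "norm (x, z) < 1" using U[of z] z by (simp add: U_iff)
    then show "\<exists>D. ((\<lambda>z. u (x, z) - z * W (x, y)) has_real_derivative D) (at z) \<and> D \<le> 0"
      using U[of z] z assms W_antimono[of y z x]
      by (intro exI[of _ "W (x, z) - W (x, y)"] conjI) (auto intro!: derivative_eq_intros du_y)
  qed (use assms in \<open>auto intro!: continuous_intros cont_vertical\<close>)
  then show "u (x, y + h) - u (x, y) \<le> h * W (x, y)" by (simp add: algebra_simps)
qed

text \<open>The one-sided difference quotient lies between \<open>W (x, h)\<close> and
  \<open>W (x, 0)\<close>, and the former tends to the latter. The boundary condition thus becomes a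
  pointwise identity for the extension \<open>W\<close>.\<close>

lemma W_flat:
  assumes "norm x < 1"
  shows "W (x, 0) = penalty \<epsilon> (u (x, 0))"
proof -
  have n: "norm (x, 0 :: real) < 1" using assms by (simp add: norm_Pair)
  have lim: "((\<lambda>h. (u (x, h) - u (x, 0)) / h) \<longlongrightarrow> penalty \<epsilon> (u (x, 0))) (at_right 0)"
    using flat_derivative[OF assms] by (simp add: has_field_derivative_iff)
  have "((\<lambda>h. (x, h)) \<longlongrightarrow> (x, 0 :: real)) (at_right 0)" by (intro tendsto_intros)
  moreover have "open {p :: (real^'m) \<times> real. norm p < 1}" by (intro open_Collect_less continuous_intros)
  ultimately have "\<forall>\<^sub>F h in at_right (0::real). norm (x, h) < 1"
    using n topological_tendstoD[of "\<lambda>h. (x, h)" "(x, 0 :: real)" "at_right 0" "{p. norm p < 1}"] by simp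
  moreover have "\<forall>\<^sub>F h in at_right (0::real). 0 < h" by (simp add: eventually_at_right_less)
  ultimately have ev: "\<forall>\<^sub>F h in at_right 0. W (x, 0 + h) \<le> (u (x, h) - u (x, 0)) / h \<and>
      (u (x, h) - u (x, 0)) / h \<le> W (x, 0)"
    by eventually_elim (use difference_bounds[of 0 _ x] in \<open>auto simp: field_simps\<close>)
  have "W (x, 0) \<le> penalty \<epsilon> (u (x, 0))"
    by (rule tendsto_le[OF trivial_limit_at_right_real lim tendsto_vertical[OF n]])
      (use ev in \<open>auto elim: eventually_mono\<close>)
  moreover have "penalty \<epsilon> (u (x, 0)) \<le> W (x, 0)"
    by (rule tendsto_upperbound[OF lim]) (use ev in \<open>auto elim: eventually_mono\<close>)
  ultimately show ?thesis by simp
qed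

lemma W_nonpos:
  assumes "0 \<le> y" "norm (x, y) < 1"
  shows "W (x, y) \<le> 0"
proof -
  have "norm x < 1" using assms norm_fst_le[of x y] by simp
  then have "W (x, 0) \<le> 0" using W_flat[of x] eps by (simp add: penalty_def divide_nonpos_pos)
  then show ?thesis using W_antimono[of 0 y x] assms by simp
qed

text \<open>As \<open>W \<le> 0\<close>, \<open>u\<close> decreases upward until it meets the
  sphere, so \<open>u (x, 3/4)\<close> is at least \<open>- M\<close>, while
  \<open>u \<le> M\<close> below. A drop of at most \<open>2 * M\<close> over a height of at least
  \<open>1/8\<close> bounds the slope at the lower end by concavity, whence
  \<open>16 * M\<close>.\<close>

lemma W_lower:
  assumes x: "norm x \<le> 1/2" and y: "0 \<le> y" "y \<le> 5/8"
  shows "- (16 * M) \<le> W (x, y)"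
proof -
  have in1: "norm (x, b) < 1" if "0 \<le> b" "b \<le> 3/4" for b :: real
    using that x norm_pair_less[where y = b and b = "4/5" and x = x and a = "1/2" and r = 1] by (simp add: power2_eq_square)
  have low: "- M \<le> u (x, 3/4)"
  proof -
    define Y where "Y = sqrt (1 - (norm x)\<^sup>2)"
    have "(norm x)\<^sup>2 \<le> (1/2)\<^sup>2" using x by (intro power_mono) auto
    then have x2: "(norm x)\<^sup>2 \<le> 1/4" by (simp add: power2_eq_square)
    then have Y2: "Y\<^sup>2 = 1 - (norm x)\<^sup>2" by (simp add: Y_def)
    have Y: "3/4 \<le> Y" unfolding Y_def using x2 by (intro real_le_rsqrt) (simp add: power2_eq_square)
    have n1: "norm (x, Y) = 1" using Y2 by (simp add: norm_Pair)
    have "u (x, 3/4) \<ge> u (x, Y)"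
    proof (rule DERIV_nonpos_imp_decreasing_open[OF Y])
      fix z assume z: "3/4 < z" "z < Y"
      then have "z\<^sup>2 < Y\<^sup>2" by (intro power_strict_mono) auto
      then have "norm (x, z) < norm (x, Y)" by (simp add: norm_Pair)
      then show "\<exists>D. ((\<lambda>z. u (x, z)) has_real_derivative D) (at z) \<and> D \<le> 0"
        using du_y[of x z] W_nonpos[of z x] n1 z by (intro exI[of _ "W (x, z)"]) (simp add: U_iff)
    qed (use n1 in \<open>auto intro!: cont_vertical\<close>)
    moreover have "u (x, Y) = \<phi> (x, Y)" using sphere_eq n1 Y by simp
    moreover have "\<bar>\<phi> (x, Y)\<bar> \<le> M" using M n1 by simp
    ultimately show ?thesis by linarith
  qed
  have pos: "- (16 * M) \<le> W (x, z)" if z: "0 < z" "z \<le> 5/8" for z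
  proof -
    have "u (x, 3/4) - u (x, z) \<le> (3/4 - z) * W (x, z)"
      using difference_bounds(2)[of z "3/4 - z" x] in1[of "3/4"] z by simp
    moreover have "u (x, z) \<le> M" using u_le_M in1[of z] z by (simp add: U_iff)
    ultimately have "- (2 * M) \<le> (3/4 - z) * W (x, z)" using low by linarith
    also have "\<dots> \<le> (1/8) * W (x, z)"
      using W_nonpos[of z x] in1[of z] z by (intro mult_right_mono_neg) auto
    finally show ?thesis by simp
  qed
  show ?thesis
  proof (cases "y = 0")
    case True
    then show ?thesis using W_antimono[of 0 "1/2" x] pos[of "1/2"] in1[of "1/2"] by simp
  qed (use pos y in auto)
qed

lemma supporting_direction:
  assumes x0: "norm x0 < 1"
  obtains e where "norm e = 1" "\<And>x. norm x < 1 \<Longrightarrow> 0 \<le> (x - x0) \<bullet> e \<Longrightarrow> W (x0, 0) \<le> W (x, 0)"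
proof -
  define S where "S = ball 0 1 \<inter> (\<lambda>x. u (x, 0)) -` {..<u (x0, 0)}"
  have cb: "(x, 0) \<in> closed_half_ball 1" if "norm x < 1" for x :: "real^'m"
    using that by (simp add: norm_Pair)
  have "continuous_on (ball 0 1) (\<lambda>x. u (x, 0))"
    by (rule continuous_on_compose2[OF cont_u]) (auto intro!: continuous_intros simp: norm_Pair)
  then have "open S" unfolding S_def by (intro continuous_open_preimage) auto
  have "convex S"
    unfolding convex_alt
  proof (intro ballI allI impI)
    fix a b l assume a: "a \<in> S" "b \<in> S" and l: "0 \<le> l \<and> l \<le> (1::real)"
    have "(1 - l) *\<^sub>R a + l *\<^sub>R b \<in> ball 0 1"
      using convexD_alt[OF convex_ball[of 0 1], of a b l] a l by (simp add: S_def)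
    moreover have "u ((1 - l) *\<^sub>R a + l *\<^sub>R b, 0) < u (x0, 0)"
    proof -
      have ab: "u (a, 0) < u (x0, 0)" "u (b, 0) < u (x0, 0)" using a by (auto simp: S_def)
      have "u ((1 - l) *\<^sub>R a + l *\<^sub>R b, 0) \<le> (1 - l) * u (a, 0) + l * u (b, 0)"
        using a l by (intro convex_horizontal cb) (auto simp: S_def)
      also have "\<dots> < u (x0, 0)"
        using ab l by (intro convex_bound_lt) auto
      finally show ?thesis .
    qed
    ultimately show "(1 - l) *\<^sub>R a + l *\<^sub>R b \<in> S" by (simp add: S_def)
  qed
  then have "convex ((\<lambda>x. x - x0) ` S)" by (rule convex_translation_subtract)
  moreover have "0 \<notin> (\<lambda>x. x - x0) ` S" by (auto simp: S_def)
  ultimately obtain a where a: "a \<noteq> 0" "\<And>x. x \<in> S \<Longrightarrow> 0 \<le> a \<bullet> (x - x0)"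
    using separating_hyperplane_set_0[of "(\<lambda>x. x - x0) ` S"] by auto
  \<comment> \<open>As \<open>S\<close> is open, a small step against \<open>a\<close> stays in
    \<open>S\<close> and upgrades weak separation to strict. Hence the closed half space on the
    other side of \<open>x0\<close>, including its bounding hyperplane, misses
    \<open>S\<close>.\<close>
  have strict: "0 < a \<bullet> (x - x0)" if "x \<in> S" for x
  proof -
    obtain d where d: "d > 0" "ball x d \<subseteq> S" using \<open>open S\<close> \<open>x \<in> S\<close> open_contains_ball by blast
    have "x - (d / (2 * norm a)) *\<^sub>R a \<in> ball x d" using d a by (simp add: dist_norm)
    then have "0 \<le> a \<bullet> (x - (d / (2 * norm a)) *\<^sub>R a - x0)" using d a(2) by blast
    also have "\<dots> = a \<bullet> (x - x0) - d / (2 * norm a) * (a \<bullet> a)" by (simp add: inner_diff_right)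
    finally have "d / (2 * norm a) * (a \<bullet> a) \<le> a \<bullet> (x - x0)" by simp
    moreover have "0 < d / (2 * norm a) * (a \<bullet> a)" using d a by simp
    ultimately show ?thesis by linarith
  qed
  show ?thesis
  proof (rule that[of "(- 1 / norm a) *\<^sub>R a"])
    show "norm ((- 1 / norm a) *\<^sub>R a) = 1" using a by simp
    fix x assume x: "norm x < 1" "0 \<le> (x - x0) \<bullet> ((- 1 / norm a) *\<^sub>R a)"
    then have "a \<bullet> (x - x0) \<le> 0" using a(1) by (simp add: inner_commute divide_le_0_iff)
    then have "x \<notin> S" using strict[of x] by auto
    then have "u (x0, 0) \<le> u (x, 0)" using x by (simp add: S_def)
    then have "penalty \<epsilon> (u (x0, 0)) \<le> penalty \<epsilon> (u (x, 0))"
      using eps by (auto simp: penalty_def divide_right_mono divide_nonpos_pos)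
    then show "W (x0, 0) \<le> W (x, 0)" using W_flat x x0 by simp
  qed
qed

end

subsection \<open>Hoelder estimates\<close>

text \<open>Used to keep a path that moves one coordinate at a time inside the ball around its
  starting point.\<close>

lemma norm_partial_sum_le:
  fixes v :: "'a::euclidean_space"
  assumes "A \<subseteq> Basis"
  shows "norm (\<Sum>i\<in>A. (v \<bullet> i) *\<^sub>R i) \<le> norm v"
proof (rule norm_le_componentwise)
  fix b :: 'a assume b: "b \<in> Basis"
  have "finite A" using assms finite_Basis by (rule finite_subset)
  have "(\<Sum>i\<in>A. (v \<bullet> i) *\<^sub>R i) \<bullet> b = (\<Sum>i\<in>A. if i = b then v \<bullet> i else 0)"
    unfolding inner_sum_left using assms b by (intro sum.cong) (auto simp: inner_Basis)
  also have "\<dots> = (if b \<in> A then v \<bullet> b else 0)" using \<open>finite A\<close> by simp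
  finally show "\<bar>(\<Sum>i\<in>A. (v \<bullet> i) *\<^sub>R i) \<bullet> b\<bar> \<le> \<bar>v \<bullet> b\<bar>" by simp
qed

context convex_solution
begin



section \<open>Comparison at flat points\<close>

text \<open>The product of the bound \<open>16 * M\<close> from \<open>W_lower\<close>, the factor
  \<open>2 * n + 1\<close> from \<open>slit_comparison\<close>, and 2, the inverse square root of
  the comparison radius \<open>1/4\<close>.\<close>

definition flat_const :: real where "flat_const = 32 * M * (2 * n + 1)"

text \<open>
  The normal derivative of a \<open>C\<^sup>2\<close> function is only \<open>C\<^sup>1\<close>, so the maximum principle is applied to
  difference quotients instead.
\<close>

definition quot :: "real \<Rightarrow> (real^'m) \<times> real \<Rightarrow> real" where
  "quot h p = 1 / h * (u (p + (0, h)) - u p)"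

lemma n_nonneg: "0 \<le> n" by (simp add: dim_eq)

lemma flat_const_nonneg: "0 \<le> flat_const" unfolding flat_const_def using M0 n_nonneg by simp

lemma quot_bounds:
  assumes "0 < h" "0 \<le> snd p" "norm (p + (0, h)) < 1"
  shows "W (p + (0, h)) \<le> quot h p" "quot h p \<le> W p"
proof -
  obtain x y where p: "p = (x, y)" by (cases p)
  show "W (p + (0, h)) \<le> quot h p" "quot h p \<le> W p"
    using difference_bounds[of y h x] assms by (auto simp: p quot_def field_simps)
qed

lemma norm_add_vertical: "0 \<le> h \<Longrightarrow> norm (p + (0 :: real^'m, h :: real)) \<le> norm p + h"
  using norm_triangle_ineq[of p "(0 :: real^'m, h)"] by (simp add: norm_Pair)

lemma quot_harmonic:
  assumes "0 < h" "0 < snd p" "norm p + h < 1"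
  shows "has_lap (quot h) p 0"
proof -
  have "p \<in> U" "p + (0, h) \<in> U"
    using assms norm_add_vertical[of h p] by (auto simp: U_iff)
  then have "has_lap (\<lambda>p. 1 / h * (u (p + (0, h)) - u p)) p (1 / h * (0 - 0))"
    by (intro has_lap_cmult has_lap_diff has_lap_translate[of u] has_lap_u)
  then show ?thesis by (simp add: quot_def[abs_def])
qed

lemma continuous_on_quot:
  assumes "0 < h" "\<And>p. p \<in> S \<Longrightarrow> 0 \<le> snd p \<and> norm p + h \<le> 1"
  shows "continuous_on S (quot h)"
proof -
  have sub: "S \<subseteq> closed_half_ball 1" using assms by force
  have sub': "(\<lambda>p. p + (0, h)) ` S \<subseteq> closed_half_ball 1"
  proof (rule image_subsetI)
    fix p assume "p \<in> S"
    then show "p + (0, h) \<in> closed_half_ball 1"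
      using assms(2)[of p] norm_add_vertical[of h p] assms(1) by simp
  qed
  show ?thesis
    unfolding quot_def
    by (intro continuous_intros continuous_on_subset[OF cont_u sub]
      continuous_on_compose2[OF cont_u _ sub'])
qed

text \<open>The increment over a fixed height \<open>h\<close> has vertical derivative
  \<open>W (x, z + h) - W (x, z) \<le> 0\<close>. This supplies the Neumann-side hypothesis of
  \<open>slit_comparison\<close>.\<close>

lemma quot_antimono:
  assumes "0 < h" "0 \<le> y" "norm (x, y + h) < 1"
  shows "quot h (x, y) \<le> quot h (x, 0)"
proof -
  have "u (x, y + h) - u (x, y) \<le> u (x, 0 + h) - u (x, 0)"
  proof (rule DERIV_nonpos_imp_decreasing_open[where f = "\<lambda>y. u (x, y + h) - u (x, y)"])
    fix z assume z: "0 < z" "z < y"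
    have n: "norm (x, z) < 1" "norm (x, z + h) < 1"
      using vertical_in[of _ "y + h" x] z assms by auto
    have "((\<lambda>z. u (x, z + h)) has_real_derivative W (x, z + h)) (at z)"
      using du_y[of x "z + h"] n z assms by (simp add: DERIV_shift U_iff)
    then have "((\<lambda>z. u (x, z + h) - u (x, z)) has_real_derivative W (x, z + h) - W (x, z)) (at z)"
      using du_y[of x z] n z by (intro DERIV_diff) (auto simp: U_iff)
    moreover have "W (x, z + h) \<le> W (x, z)" using W_antimono[of z "z + h" x] n z assms by simp
    ultimately show "\<exists>D. ((\<lambda>z. u (x, z + h) - u (x, z)) has_real_derivative D) (at z) \<and> D \<le> 0"
      by (intro exI[of _ "W (x, z + h) - W (x, z)"]) simp
  next
    have "norm (x, y) \<le> 1" using vertical_in[of y "y + h" x] assms by simp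
    moreover have "continuous_on {0..y} (\<lambda>y. u (x, y + h))"
      by (rule continuous_on_compose2[OF cont_vertical[of h x "y + h"]])
        (use assms in \<open>auto intro!: continuous_intros\<close>)
    ultimately show "continuous_on {0..y} (\<lambda>y. u (x, y + h) - u (x, y))"
      by (intro continuous_on_diff cont_vertical) auto
  qed (use assms in auto)
  then show ?thesis using assms by (simp add: quot_def divide_right_mono)
qed

text \<open>The comparison is applied to \<open>quot h\<close> shifted by
  \<open>\<delta> - W (x0, 0)\<close>. On the Dirichlet side the quotient is only known to exceed
  \<open>W (x, h)\<close>, not \<open>W (x, 0)\<close>; uniform continuity of \<open>W\<close> makes
  that loss less than \<open>\<delta>\<close> for small \<open>h\<close>. Only \<open>h\<close>
  depends on \<open>\<delta>\<close> and on the solution, the constant does not.\<close>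

lemma W_ge_flat:
  assumes x0: "norm x0 \<le> 1/4" and p: "dist (x0, 0) p \<le> 1/4" "0 \<le> snd p"
  shows "W (x0, 0) - flat_const * sqrt (dist (x0, 0) p) \<le> W p"
proof (rule field_le_epsilon)
  fix \<delta> :: real assume \<delta>: "\<delta> > 0"
  obtain e where e: "norm e = 1" "\<And>x. norm x < 1 \<Longrightarrow> 0 \<le> (x - x0) \<bullet> e \<Longrightarrow> W (x0, 0) \<le> W (x, 0)"
    using supporting_direction[of x0] x0 by auto
  let ?K2 = "closed_half_ball (7/8) :: ((real^'m) \<times> real) set"
  have "compact ?K2"
    by (intro compact_Int_closed compact_cball closed_Collect_le continuous_intros)
  moreover have "continuous_on ?K2 W"
  proof (rule continuous_on_subset[OF contW], rule subsetI)
    fix z assume "z \<in> ?K2"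
    then show "z \<in> U \<union> flat_ball 1" unfolding UF_iff by simp
  qed
  ultimately have "uniformly_continuous_on ?K2 W" by (intro compact_uniformly_continuous)
  then obtain \<eta> where \<eta>: "\<eta> > 0"
    "\<And>z z'. z \<in> ?K2 \<Longrightarrow> z' \<in> ?K2 \<Longrightarrow> dist z' z < \<eta> \<Longrightarrow> dist (W z') (W z) < \<delta>"
    using \<delta> by (rule uniformly_continuous_onE) blast
  define h where "h = min (\<eta> / 2) (1/8)"
  have h: "0 < h" "h < \<eta>" "h \<le> 1/8" using \<eta> by (auto simp: h_def)
  let ?K = "cball (x0, 0) (1/4) \<inter> {p :: (real^'m) \<times> real. 0 \<le> snd p}"
  have Kn: "norm z \<le> 1/2" "0 \<le> snd z" if "z \<in> ?K" for z
  proof -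
    have "norm z \<le> norm (x0, 0 :: real) + dist (x0, 0) z"
      by (metis dist_commute dist_norm norm_triangle_sub)
    then show "norm z \<le> 1/2" using that x0 by (simp add: norm_Pair)
  qed (use that in simp)
  have x0n: "norm (x0, 0 :: real) < 1" using x0 by (simp add: norm_Pair)
  have "- ((16 * M) * (2 * n + 1) * sqrt (dist (x0, 0) p / (1/4))) \<le> quot h p + (\<delta> - W (x0, 0))"
  unfolding dim_eq
  proof (rule slit_comparison[where f = "\<lambda>p. quot h p + (\<delta> - W (x0, 0))" and e = e])
    show "continuous_on ?K (\<lambda>p. quot h p + (\<delta> - W (x0, 0)))"
    proof (intro continuous_intros continuous_on_quot)
      fix z assume "z \<in> ?K"
      then show "0 \<le> snd z \<and> norm z + h \<le> 1" using Kn[of z] h by simp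
    qed (use h in simp)
    show "has_lap (\<lambda>p. quot h p + (\<delta> - W (x0, 0))) z 0" if "z \<in> ?K" "0 < snd z" for z
      using has_lap_add[OF quot_harmonic[of h z] has_lap_const[of "\<delta> - W (x0, 0)" z]]
        Kn[OF that(1)] that h by simp
    show "- (16 * M) \<le> quot h z + (\<delta> - W (x0, 0))" if "z \<in> ?K" for z
    proof -
      have z: "norm (z + (0, h)) < 1" using norm_add_vertical[of h z] Kn[OF that] h by simp
      have "norm (fst z) \<le> 1/2" using norm_fst_le[of "fst z" "snd z"] Kn[OF that] by simp
      moreover have "snd z \<le> 1/2" using norm_snd_le[of "snd z" "fst z"] Kn[OF that] by simp
      ultimately have "- (16 * M) \<le> W (fst z, snd z + h)"
        using Kn[OF that] h by (intro W_lower) auto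
      also have "(fst z, snd z + h) = z + (0, h)" by (simp add: prod_eq_iff)
      also have "W (z + (0, h)) \<le> quot h z" using quot_bounds(1)[OF h(1) _ z] Kn[OF that] by simp
      \<comment> \<open>The shift is positive because \<open>W (x0, 0) \<le> 0\<close>, so it can
        only improve the lower bound.\<close>
      finally show ?thesis using W_nonpos[of 0 x0] x0n \<delta> by simp
    qed
    show "0 \<le> quot h (x, 0) + (\<delta> - W (x0, 0))" if "(x, 0) \<in> ?K" "0 \<le> (x - x0) \<bullet> e" for x
    proof -
      have nx: "norm x \<le> 1/2" using Kn[OF that(1)] by (simp add: norm_Pair)
      have z: "norm (x, h) \<le> 1/2 + 1/8" using norm_pair_le[of x h] nx h by simp
      have "dist (W (x, h)) (W (x, 0)) < \<delta>"
        using nx z h by (intro \<eta>(2)) (auto simp: norm_Pair dist_Pair_Pair)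
      then have "W (x, 0) - \<delta> \<le> W (x, h)" by (simp add: dist_real_def abs_less_iff)
      also have "\<dots> \<le> quot h (x, 0)" using quot_bounds(1)[of h "(x, 0)"] h z by simp
      finally have "W (x, 0) - \<delta> \<le> quot h (x, 0)" .
      moreover have "W (x0, 0) \<le> W (x, 0)" using e(2)[of x] nx that by simp
      ultimately show ?thesis by simp
    qed
    show "quot h (x, y) + (\<delta> - W (x0, 0)) \<le> quot h (x, 0) + (\<delta> - W (x0, 0))" if "(x, y) \<in> ?K" for x y
    proof -
      have "norm ((x, y) + (0, h)) \<le> norm (x, y) + h" using norm_add_vertical[of h "(x, y)"] h by simp
      then have "norm (x, y + h) < 1" using Kn[OF that] h by simp
      then show ?thesis using quot_antimono[of h y x] Kn[OF that] h by simp
    qed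
  qed (use e M0 p in auto)
  moreover have "sqrt (dist (x0, 0) p / (1/4)) = 2 * sqrt (dist (x0, 0) p)"
    by (simp add: real_sqrt_mult)
  ultimately have "- (flat_const * sqrt (dist (x0, 0) p)) \<le> quot h p + (\<delta> - W (x0, 0))"
    unfolding flat_const_def by (simp add: algebra_simps)
  moreover have "quot h p \<le> W p"
  proof (rule quot_bounds(2)[OF h(1) p(2)])
    show "norm (p + (0, h)) < 1" using norm_add_vertical[of h p] Kn[of p] p h by simp
  qed
  ultimately show "W (x0, 0) - flat_const * sqrt (dist (x0, 0) p) \<le> W p + \<delta>" by simp
qed

lemma W_flat_holder:
  assumes "norm x0 \<le> 1/4" "norm x1 \<le> 1/4" "dist x0 x1 \<le> 1/4"
  shows "\<bar>W (x0, 0) - W (x1, 0)\<bar> \<le> flat_const * sqrt (dist x0 x1)"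
  using W_ge_flat[of x0 "(x1, 0)"] W_ge_flat[of x1 "(x0, 0)"] assms
  by (simp add: dist_Pair_Pair dist_commute abs_le_iff)

lemma W_near_flat:
  assumes "norm x0 \<le> 1/4" "norm (fst p) \<le> 1/4" "dist (x0, 0) p \<le> 1/4" "0 \<le> snd p" "norm p < 1"
  shows "\<bar>W p - W (x0, 0)\<bar> \<le> flat_const * sqrt (dist (x0, 0) p)"
proof -
  obtain x y where p: "p = (x, y)" by (cases p)
  have d: "dist x0 x \<le> dist (x0, 0) p" using dist_fst_le[of "(x0, 0)" p] by (simp add: p)
  have "W p \<le> W (x, 0)" using W_antimono[of 0 y x] assms by (simp add: p)
  moreover have "W (x, 0) - W (x0, 0) \<le> flat_const * sqrt (dist x0 x)"
    using W_flat_holder[of x0 x] assms d by (simp add: p)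
  moreover have "flat_const * sqrt (dist x0 x) \<le> flat_const * sqrt (dist (x0, 0) p)"
    using flat_const_nonneg d by (intro mult_left_mono) auto
  ultimately show ?thesis using W_ge_flat[of x0 p] assms by (simp add: abs_le_iff)
qed

section \<open>From flat points to arbitrary pairs\<close>

text \<open>The ball of radius \<open>Y / 4\<close> about the midpoint \<open>c\<close> of the
  segment stays away from the flat part and, even after a shift by \<open>h < Y / 4\<close>, within
  \<open>2 * Y\<close> of \<open>(x0, 0)\<close>. There \<open>W\<close> oscillates by at most
  \<open>A\<close> according to \<open>W_near_flat\<close>, so the interior estimate bounds the
  quotients; \<open>h\<close> then tends to 0.\<close>

lemma W_axis_lipschitz:
  assumes x0: "norm x0 \<le> 1/16" and Y: "0 < Y" "Y \<le> 1/16" and b: "b \<in> Basis"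
    and s: "\<bar>s\<bar> \<le> Y / 4"
    and near: "dist (x0, Y) (z + (s / 2) *\<^sub>R b) \<le> Y / 4"
  shows "\<bar>W (z + s *\<^sub>R b) - W z\<bar> \<le> 4 * n * flat_const * sqrt (2 * Y) * \<bar>s\<bar> / Y"
proof -
  define c where "c = z + (s / 2) *\<^sub>R b"
  define A where "A = 2 * (flat_const * sqrt (2 * Y))"
  have zc: "z + s *\<^sub>R b = c + (s / 2) *\<^sub>R b" "z = c - (s / 2) *\<^sub>R b"
    by (simp_all add: c_def scaleR_add_left[symmetric])
  have pt: "0 < snd w" "norm (fst w) \<le> 1/4" "dist (x0, 0) w \<le> 7/4 * Y" "norm w \<le> 1/4"
    if "w \<in> cball c (Y / 4)" for w
  proof -
    have d: "dist (x0, Y) w \<le> Y / 2"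
      using dist_triangle[of "(x0, Y)" w c] near that by (simp add: c_def)
    have "\<bar>Y - snd w\<bar> \<le> Y / 2" using dist_snd_le[of "(x0, Y)" w] d by (simp add: dist_real_def)
    then show "0 < snd w" using Y by linarith
    have "dist (x0, 0) (x0, Y) = Y" using Y by (simp add: dist_Pair_Pair)
    then show d0: "dist (x0, 0) w \<le> 7/4 * Y" using dist_triangle[of "(x0, 0)" w "(x0, Y)"] d Y by simp
    have "norm w \<le> norm (x0, 0 :: real) + dist (x0, 0) w"
      by (metis dist_commute dist_norm norm_triangle_sub)
    then show "norm w \<le> 1/4" using d0 x0 Y by (simp add: norm_Pair)
    then show "norm (fst w) \<le> 1/4" using norm_fst_le[of "fst w" "snd w"] by simp
  qed
  have osc: "\<bar>W w - W (x0, 0)\<bar> \<le> flat_const * sqrt (2 * Y)"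
    if "dist (x0, 0) w \<le> 2 * Y" "norm (fst w) \<le> 1/4" "0 \<le> snd w" "norm w < 1" for w
  proof -
    have "\<bar>W w - W (x0, 0)\<bar> \<le> flat_const * sqrt (dist (x0, 0) w)"
      using that x0 Y by (intro W_near_flat) auto
    also have "\<dots> \<le> flat_const * sqrt (2 * Y)" using flat_const_nonneg that by (intro mult_left_mono) auto
    finally show ?thesis .
  qed
  have up: "dist (x0, 0) (w + (0, h)) \<le> 2 * Y" "norm (fst (w + (0, h))) \<le> 1/4" "0 \<le> snd (w + (0, h))"
    "norm (w + (0, h)) < 1" if "w \<in> cball c (Y / 4)" "0 \<le> h" "h < Y / 4" for w h
  proof -
    have "dist w (w + (0, h)) = h" using that by (simp add: dist_norm norm_Pair)
    then show "dist (x0, 0) (w + (0, h)) \<le> 2 * Y"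
      using dist_triangle[of "(x0, 0)" "w + (0, h)" w] pt[OF that(1)] that Y by simp
    show "norm (fst (w + (0, h))) \<le> 1/4" "0 \<le> snd (w + (0, h))" using pt[OF that(1)] that by auto
    show "norm (w + (0, h)) < 1" using norm_add_vertical[of h w] pt[OF that(1)] that Y by simp
  qed
  have key: "\<bar>quot h (c + (s / 2) *\<^sub>R b) - quot h (c - (s / 2) *\<^sub>R b)\<bar> \<le> n * A * \<bar>s / 2\<bar> / (Y / 4)"
    if h: "0 < h" "h < Y / 4" for h
    unfolding dim_eq
  proof (rule harmonic_axis_lipschitz_abs[OF b])
    show "continuous_on (cball c (Y / 4)) (quot h)"
    proof (rule continuous_on_quot[OF h(1)])
      show "0 \<le> snd w \<and> norm w + h \<le> 1" if "w \<in> cball c (Y / 4)" for w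
        using pt[OF that] h Y by simp
    qed
    show "has_lap (quot h) w 0" if "w \<in> ball c (Y / 4)" for w
      using pt[of w] that h Y by (intro quot_harmonic) auto
    show "quot h w - quot h w' \<le> A" if w: "w \<in> cball c (Y / 4)" "w' \<in> cball c (Y / 4)" for w w'
    proof -
      have "quot h w \<le> W w" using quot_bounds(2)[OF h(1)] up[OF w(1)] pt[OF w(1)] h by simp
      moreover have "W (w' + (0, h)) \<le> quot h w'"
        using quot_bounds(1)[OF h(1)] up[OF w(2)] pt[OF w(2)] h by simp
      moreover have "\<bar>W w - W (x0, 0)\<bar> \<le> flat_const * sqrt (2 * Y)"
        using pt[OF w(1)] Y by (intro osc) auto
      moreover have "\<bar>W (w' + (0, h)) - W (x0, 0)\<bar> \<le> flat_const * sqrt (2 * Y)"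
        using up[OF w(2), of h] h by (intro osc) auto
      ultimately show ?thesis by (simp add: A_def abs_le_iff)
    qed
  qed (use Y s in auto)
  have zin: "z \<in> cball c (Y / 4)" "z + s *\<^sub>R b \<in> cball c (Y / 4)"
  proof -
    have "dist c z = \<bar>s\<bar> / 2" "dist c (z + s *\<^sub>R b) = \<bar>s\<bar> / 2"
      unfolding zc(1) using b by (simp_all add: c_def dist_norm)
    then show "z \<in> cball c (Y / 4)" "z + s *\<^sub>R b \<in> cball c (Y / 4)" using s Y by simp_all
  qed
  have lim: "((\<lambda>h. quot h w) \<longlongrightarrow> W w) (at_right 0)" if w: "w \<in> cball c (Y / 4)" for w
  proof (rule tendsto_sandwich)
    have ev: "\<forall>\<^sub>F h in at_right 0. 0 < h \<and> h < Y / 4"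
      using eventually_at_right_real[of 0 "Y / 4"] Y by (auto elim: eventually_mono)
    then show "\<forall>\<^sub>F h in at_right 0. quot h w \<le> W w"
      by eventually_elim (use quot_bounds(2) up(4)[OF w] pt[OF w] in auto)
    show "\<forall>\<^sub>F h in at_right 0. W (fst w, snd w + h) \<le> quot h w"
      using ev
    proof eventually_elim
      case (elim h)
      have "(fst w, snd w + h) = w + (0, h)" by (simp add: prod_eq_iff)
      then show ?case using quot_bounds(1)[of h w] up(4)[OF w, of h] pt[OF w] elim by simp
    qed
    show "((\<lambda>h. W (fst w, snd w + h)) \<longlongrightarrow> W w) (at_right 0)"
      using tendsto_vertical[of "fst w" "snd w"] pt[OF w] by simp
  qed auto
  have "\<forall>\<^sub>F h in at_right 0. \<bar>quot h (z + s *\<^sub>R b) - quot h z\<bar> \<le> n * A * \<bar>s / 2\<bar> / (Y / 4)"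
    using eventually_at_right_real[of 0 "Y / 4"] Y key[folded zc] by (auto elim: eventually_mono)
  moreover have "((\<lambda>h. \<bar>quot h (z + s *\<^sub>R b) - quot h z\<bar>) \<longlongrightarrow> \<bar>W (z + s *\<^sub>R b) - W z\<bar>) (at_right 0)"
    by (intro tendsto_intros lim zin)
  ultimately have "\<bar>W (z + s *\<^sub>R b) - W z\<bar> \<le> n * A * \<bar>s / 2\<bar> / (Y / 4)"
    by (intro tendsto_upperbound) auto
  also have "\<dots> = 4 * n * flat_const * sqrt (2 * Y) * \<bar>s\<bar> / Y" by (simp add: A_def field_simps)
  finally show ?thesis .
qed

text \<open>The increment \<open>v\<close> is traversed one coordinate at a time, which accounts for
  the outer factor \<open>n\<close>. The midpoint of each step lies in the ball of radius
  \<open>Y / 4\<close> because both ends do and the ball is convex.\<close>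

lemma W_interior_lipschitz:
  assumes x0: "norm x0 \<le> 1/16" and Y: "0 < Y" "Y \<le> 1/16" and v: "norm v \<le> Y / 4"
  shows "\<bar>W ((x0, Y) + v) - W (x0, Y)\<bar> \<le> n * (4 * n * flat_const * sqrt (2 * Y) * norm v / Y)"
proof -
  define G where "G = 4 * n * flat_const * sqrt (2 * Y) * norm v / Y"
  define z where "z A = (x0, Y) + (\<Sum>i\<in>A. (v \<bullet> i) *\<^sub>R i)" for A
  have "\<bar>W (z A) - W (x0, Y)\<bar> \<le> card A * G" if "A \<subseteq> Basis" for A
    using finite_subset[OF that finite_Basis] that
  proof (induction A rule: finite_induct)
    case empty
    then show ?case by (simp add: z_def)
  next
    case (insert j A)
    let ?s = "v \<bullet> j"
    have zi: "z (insert j A) = z A + ?s *\<^sub>R j" using insert by (simp add: z_def algebra_simps)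
    have s: "\<bar>?s\<bar> \<le> norm v" using insert by (intro Basis_le_norm) auto
    have d: "dist (x0, Y) (z B) \<le> Y / 4" if "B \<subseteq> Basis" for B
      using norm_partial_sum_le[OF that, of v] v by (simp add: z_def dist_norm)
    have "z A + (?s / 2) *\<^sub>R j = (1 - 1/2) *\<^sub>R z A + (1/2) *\<^sub>R z (insert j A)"
      unfolding zi by (simp add: scaleR_add_right scaleR_add_left[symmetric] add.assoc[symmetric])
    moreover have "(1 - 1/2) *\<^sub>R z A + (1/2) *\<^sub>R z (insert j A) \<in> cball (x0, Y) (Y / 4)"
      using d[of A] d[of "insert j A"] insert by (intro convexD_alt[OF convex_cball]) auto
    ultimately have "dist (x0, Y) (z A + (?s / 2) *\<^sub>R j) \<le> Y / 4" by simp
    then have "\<bar>W (z A + ?s *\<^sub>R j) - W (z A)\<bar> \<le> 4 * n * flat_const * sqrt (2 * Y) * \<bar>?s\<bar> / Y"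
      using insert s v by (intro W_axis_lipschitz[OF x0 Y]) auto
    also have "\<dots> \<le> G"
      unfolding G_def using s Y flat_const_nonneg n_nonneg by (intro divide_right_mono mult_left_mono) auto
    finally have "\<bar>W (z (insert j A)) - W (z A)\<bar> \<le> G" unfolding zi .
    moreover have "\<bar>W (z A) - W (x0, Y)\<bar> \<le> card A * G" using insert by simp
    ultimately show ?case using insert by (simp add: algebra_simps abs_le_iff)
  qed
  from this[of Basis] show ?thesis by (simp add: z_def G_def euclidean_representation dim_eq)
qed

text \<open>The summand \<open>4 * n\<^sup>2\<close> covers points close together relative to their
  height; 5 covers the others, as 2 for each vertical drop to the flat part plus 1 for the flat
  difference.\<close>

definition holder_const :: real where "holder_const = (4 * n\<^sup>2 + 5) * flat_const"

text \<open>Let \<open>y\<close> be the larger height and \<open>D\<close> the distance. If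
  \<open>D \<le> y / 4\<close>, the Lipschitz bound of order \<open>sqrt y * D / y\<close> is
  absorbed by \<open>sqrt D\<close>. Otherwise both heights are below \<open>4 * D\<close>, and
  passing through the two vertical projections costs only multiples of
  \<open>sqrt D\<close>.\<close>

lemma W_holder_ordered:
  assumes p: "p \<in> upper_half_ball (1/16)" and q: "q \<in> upper_half_ball (1/16)" and le: "snd q \<le> snd p"
  shows "\<bar>W p - W q\<bar> \<le> holder_const * sqrt (dist p q)"
proof -
  obtain x y where p': "p = (x, y)" by (cases p)
  obtain x' y' where q': "q = (x', y')" by (cases q)
  define D where "D = dist p q"
  have D: "0 \<le> D" by (simp add: D_def)
  have np: "norm p < 1/16" "norm q < 1/16" "0 < y" "0 < y'" "y' \<le> y"
    using p q le by (auto simp: upper_half_ball_def p' q')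
  have nx: "norm x \<le> 1/16" "norm x' \<le> 1/16" "y \<le> 1/16"
    using np norm_fst_le[of x y] norm_fst_le[of x' y'] norm_snd_le[of y x] by (auto simp: p' q')
  show ?thesis
  proof (cases "D \<le> y / 4")
    case True
    have "\<bar>W ((x, y) + (q - p)) - W (x, y)\<bar> \<le> n * (4 * n * flat_const * sqrt (2 * y) * norm (q - p) / y)"
      using nx np True by (intro W_interior_lipschitz) (auto simp: D_def dist_norm norm_minus_commute)
    then have "\<bar>W q - W p\<bar> \<le> 4 * n\<^sup>2 * flat_const * (sqrt (2 * y) * D / y)"
      by (simp add: p' D_def dist_norm norm_minus_commute power2_eq_square mult_ac)
    also have "sqrt (2 * y) * D / y \<le> sqrt D"
    proof -
      have "sqrt (2 * y) * sqrt D \<le> y"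
      proof -
        have "sqrt (2 * y) * sqrt D = sqrt (2 * y * D)" by (simp add: real_sqrt_mult)
        also have "\<dots> \<le> y"
        proof (rule real_le_lsqrt)
          have "2 * y * D \<le> 2 * y * (y / 4)" using True np by (intro mult_left_mono) auto
          also have "\<dots> \<le> y\<^sup>2" using np by (simp add: power2_eq_square)
          finally show "2 * y * D \<le> y\<^sup>2" .
        qed (use np in auto)
        finally show ?thesis .
      qed
      then have "sqrt (2 * y) * sqrt D * sqrt D \<le> y * sqrt D" using D by (intro mult_right_mono) auto
      moreover have "sqrt (2 * y) * sqrt D * sqrt D = sqrt (2 * y) * D" using D by (simp add: mult.assoc)
      ultimately have "sqrt (2 * y) * D \<le> y * sqrt D" by linarith
      then show ?thesis using np by (simp add: divide_le_eq mult.commute)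
    qed
    then have "4 * n\<^sup>2 * flat_const * (sqrt (2 * y) * D / y) \<le> 4 * n\<^sup>2 * flat_const * sqrt D"
      using flat_const_nonneg by (intro mult_left_mono) auto
    also have "\<dots> \<le> holder_const * sqrt D"
      unfolding holder_const_def using flat_const_nonneg D by (intro mult_right_mono) auto
    finally show ?thesis by (simp add: D_def abs_minus_commute)
  next
    case False
    have dv: "dist (x, 0) p = y" "dist (x', 0) q = y'" using np by (auto simp: p' q' dist_Pair_Pair)
    have dx: "dist x x' \<le> D" using dist_fst_le[of p q] by (simp add: D_def p' q')
    have dD: "D \<le> 1/8" using norm_triangle_ineq4[of p q] np by (simp add: D_def dist_norm)
    have "\<bar>W p - W (x, 0)\<bar> \<le> flat_const * sqrt (dist (x, 0) p)"
      using nx np dv by (intro W_near_flat) (auto simp: p')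
    moreover have "\<bar>W q - W (x', 0)\<bar> \<le> flat_const * sqrt (dist (x', 0) q)"
      using nx np dv by (intro W_near_flat) (auto simp: q')
    moreover have "\<bar>W (x, 0) - W (x', 0)\<bar> \<le> flat_const * sqrt (dist x x')"
      using nx dx dD by (intro W_flat_holder) auto
    moreover have "flat_const * sqrt t \<le> flat_const * (2 * sqrt D)" if "t \<le> 4 * D" for t
    proof (rule mult_left_mono)
      have "sqrt t \<le> sqrt (4 * D)" using that by simp
      then show "sqrt t \<le> 2 * sqrt D" by (simp add: real_sqrt_mult)
    qed (rule flat_const_nonneg)
    from this[of y] this[of y'] False np
    have "flat_const * sqrt y \<le> 2 * (flat_const * sqrt D)" "flat_const * sqrt y' \<le> 2 * (flat_const * sqrt D)" by auto
    moreover have "flat_const * sqrt (dist x x') \<le> flat_const * sqrt D"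
      using flat_const_nonneg dx by (intro mult_left_mono) auto
    ultimately have "\<bar>W p - W q\<bar> \<le> 5 * (flat_const * sqrt D)" unfolding dv by linarith
    also have "\<dots> = 5 * flat_const * sqrt D" by simp
    also have "\<dots> \<le> holder_const * sqrt D"
      unfolding holder_const_def using flat_const_nonneg D by (intro mult_right_mono) auto
    finally show ?thesis by (simp add: D_def)
  qed
qed

lemma W_holder:
  assumes "p \<in> upper_half_ball (1/16)" "q \<in> upper_half_ball (1/16)"
  shows "\<bar>W p - W q\<bar> \<le> holder_const * sqrt (dist p q)"
  using W_holder_ordered[of p q] W_holder_ordered[of q p] assms
  by (cases "snd q \<le> snd p") (auto simp: dist_commute abs_minus_commute)

end

lemma penalized_normal_derivative_holder:
  fixes u \<phi> :: "(real^'m) \<times> real \<Rightarrow> real"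
  assumes "\<epsilon> > 0" "penalized_solution \<epsilon> \<phi> u" "tangentially_convex u"
    and "\<And>p. p \<in> sphere 0 1 \<Longrightarrow> \<bar>\<phi> p\<bar> \<le> M" "0 \<le> M"
    and n: "n = real DIM((real^'m) \<times> real)"
    and pq: "p \<in> upper_half_ball (1/16)" "q \<in> upper_half_ball (1/16)"
  shows "\<bar>partial (0, 1) u p - partial (0, 1) u q\<bar> \<le>
    (4 * n\<^sup>2 + 5) * (32 * M * (2 * n + 1)) * sqrt (dist p q)"
proof -
  have "(0, 1) \<in> (Basis :: ((real^'m) \<times> real) set)" by (simp add: Basis_prod_def)
  then obtain W where "continuous_on (upper_half_ball 1 \<union> flat_ball 1) W"
    "\<And>p. p \<in> upper_half_ball 1 \<Longrightarrow> W p = partial (0, 1) u p"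
    using assms(2) unfolding penalized_solution_def extends_continuously_def by blast
  then interpret convex_solution \<epsilon> M n \<phi> u W using assms by unfold_locales auto
  have "upper_half_ball (1/16) \<subseteq> U" by (auto simp: upper_half_ball_def)
  then have "W p = partial (0, 1) u p" "W q = partial (0, 1) u q" using pq by (auto intro!: W)
  then show ?thesis using W_holder[OF pq] unfolding holder_const_def flat_const_def by simp
qed

theorem theorem1:
  fixes \<phi> :: "(real^'m) \<times> real \<Rightarrow> real" and \<gamma> :: real
  assumes "0 < \<gamma>" and "\<gamma> < 1"
    and "C2_holder_closure \<gamma> (ball 0 1) \<phi>"
    and "\<forall>p\<in>sphere 0 1 \<inter> {p. snd p = 0}. \<phi> p > 0"
  shows "\<exists>r \<omega>. 0 < r \<and> r < 1 \<and> modulus_of_continuity \<omega> \<and>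
    \<omega> \<in> O[at_right 0](\<lambda>\<delta>. \<delta> powr (1/2)) \<and>
    (\<forall>\<epsilon> u. \<epsilon> > 0 \<and> penalized_solution \<epsilon> \<phi> u \<and> tangentially_convex u \<and> u 0 = 0 \<longrightarrow>
      (\<forall>p\<in>upper_half_ball (r/2). \<forall>q\<in>upper_half_ball (r/2). p \<noteq> q \<longrightarrow>
        \<bar>partial (0, 1) u p - partial (0, 1) u q\<bar> \<le> \<omega> (dist p q)))"
proof -
  have "continuous_on (closure (ball 0 1)) \<phi>" using assms(3) unfolding C2_holder_closure_def by blast
  then have "continuous_on (cball 0 1) \<phi>" by simp
  then have "bounded (\<phi> ` cball 0 1)" by (intro compact_imp_bounded compact_continuous_image compact_cball)
  then obtain M where "\<forall>t\<in>\<phi> ` cball 0 1. norm t \<le> M"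
    unfolding bounded_iff by blast
  then have M: "\<bar>\<phi> p\<bar> \<le> M" if "p \<in> cball 0 1" for p
    using that by (metis image_eqI real_norm_def)
  have M0: "0 \<le> M" using M[of 0] by simp
  define n where "n = real DIM((real^'m) \<times> real)"
  \<comment> \<open>The summand 1 keeps \<open>\<omega>\<close> strictly positive when
    \<open>M = 0\<close>, as a modulus of continuity requires.\<close>
  define C where "C = (4 * n\<^sup>2 + 5) * (32 * M * (2 * n + 1)) + 1"
  have C: "C \<ge> 1" using M0 by (simp add: C_def n_def)
  define \<omega> where "\<omega> \<delta> = C * \<delta> powr (1/2)" for \<delta> :: real
  have "modulus_of_continuity \<omega>"
    unfolding modulus_of_continuity_def
  proof (intro conjI allI impI)
    show "\<omega> \<delta> > 0" if "\<delta> > 0" for \<delta> using that C by (simp add: \<omega>_def)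
    show "mono_on {0<..} \<omega>"
      using C by (auto intro!: mono_onI mult_left_mono powr_mono2 simp: \<omega>_def)
    have "((\<lambda>\<delta>. C * sqrt \<delta>) \<longlongrightarrow> C * sqrt 0) (at_right 0)" by (intro tendsto_intros)
    moreover have "\<forall>\<^sub>F \<delta> in at_right 0. C * sqrt \<delta> = \<omega> \<delta>"
      using eventually_at_right_less[of 0] by eventually_elim (simp add: \<omega>_def powr_half_sqrt)
    ultimately show "(\<omega> \<longlongrightarrow> 0) (at_right 0)" using Lim_transform_eventually by fastforce
  qed
  moreover have "\<omega> \<in> O[at_right 0](\<lambda>\<delta>. \<delta> powr (1/2))"
    unfolding \<omega>_def using C by simp
  moreover have "\<bar>partial (0, 1) u p - partial (0, 1) u q\<bar> \<le> \<omega> (dist p q)"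
    if "\<epsilon> > 0" "penalized_solution \<epsilon> \<phi> u" "tangentially_convex u"
      "p \<in> upper_half_ball (1/8/2)" "q \<in> upper_half_ball (1/8/2)" for \<epsilon> u p q
  proof -
    have "\<bar>partial (0, 1) u p - partial (0, 1) u q\<bar> \<le>
        (4 * n\<^sup>2 + 5) * (32 * M * (2 * n + 1)) * sqrt (dist p q)"
      by (rule penalized_normal_derivative_holder[OF that(1-3) M M0 n_def]) (use that in auto)
    also have "\<dots> \<le> C * sqrt (dist p q)" unfolding C_def by (intro mult_right_mono) auto
    finally show ?thesis by (simp add: \<omega>_def powr_half_sqrt)
  qed
  ultimately show ?thesis
    \<comment> \<open>Half of \<open>1/8\<close> is the radius \<open>1/16\<close> of the Hoelder
      estimate.\<close>
    by (intro exI[of _ "1/8"] exI[of _ \<omega>]) auto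
qed

end
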